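(* Let $\mathrm{Leib}$ be the operad over a field $\Bbbk$ generated by one binary operation (without symmetry) subject to the identity $$(x_1x_2)x_3-x_1(x_2x_3)+x_2(x_1x_3)=0.$$ Then $\mathrm{Leib}$ does not admit a nonsymmetric version.
   Context: **White Manin product with $\mathrm{As}$.** $\mathrm{As}$ is the (symmetric) operad of associative algebras. For a binary quadratic operad $\mathcal P$ generated by the $S_2$-module $V$ with basis $e_1=x_1\circ x_2$, $e_2=(12)e_1=x_2\circ x_1$, the white Manin product $\mathrm{As}\circ\mathcal P$ is the binary quadratic operad generated by $\mathrm{As}(2)\otimes V$ (diagonal $S_2$-action) whose space of relations is the kernel of the natural map $\mathcal F(3)\to\mathrm{As}(3)\otimes\mathcal P(3)$ induced by composing componentwise, where $\mathcal F$ is the free symmetric operad generated by $\mathrm{As}(2)\otimes V$ in arity 2. The space $\mathrm{As}(2)\otimes V$ has basis $h_1=x_1\prec x_2:=x_1x_2\otimes (x_1\circ x_2)$, $h_2=(12)h_1=x_2\prec x_1$, $g_1=x_1\succ x_2:=x_1x_2\otimes(x_2\circ x_1)$, $g_2=(12)g_1=x_2\succ x_1$. **Nonsymmetric version.** $\mathcal P$ admits a nonsymmetric version if $(\mathrm{As}\circ\mathcal P)/\{g_1-h_2=0,\ g_2-h_1=0\}\cong\mathcal P$ as operads. *)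

theory Defs
  imports
    Complex_Main
    "HOL-Library.Poly_Mapping"
    "HOL-Combinatorics.Permutations"
begin

section \<open>Symmetric operads over a field\<close>

text \<open>
  The data of a symmetric operad in vector spaces over the field \<open>'k\<close>, in the partial composition
  presentation: \<open>Ops P n\<close> is the space of operations of arity \<open>n\<close>, \<open>act P n \<sigma>\<close> is the left action
  of a permutation \<open>\<sigma>\<close> of \<open>{1..n}\<close>, and \<open>pcomp P m n i f g\<close> is \<open>f \<circ>\<^sub>i g\<close> for \<open>f\<close> of arity
  \<open>m\<close>, \<open>g\<close> of arity \<open>n\<close> and \<open>1 \<le> i \<le> m\<close>.  The other operations carry the arity as an argument
  because the same element of \<open>'a\<close> may occur in several arities.
  The action convention is \<open>(\<sigma> f)(x\<^sub>1, \<dots>, x\<^sub>n) = f(x\<^bsub>\<sigma> 1\<^esub>, \<dots>, x\<^bsub>\<sigma> n\<^esub>)\<close>.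
\<close>

record ('k, 'a) operad =
  Ops :: "nat \<Rightarrow> 'a set"
  zero_op :: "nat \<Rightarrow> 'a"
  add_op :: "nat \<Rightarrow> 'a \<Rightarrow> 'a \<Rightarrow> 'a"
  smult_op :: "nat \<Rightarrow> 'k \<Rightarrow> 'a \<Rightarrow> 'a"
  id_op :: 'a
  act :: "nat \<Rightarrow> (nat \<Rightarrow> nat) \<Rightarrow> 'a \<Rightarrow> 'a"
  pcomp :: "nat \<Rightarrow> nat \<Rightarrow> nat \<Rightarrow> 'a \<Rightarrow> 'a \<Rightarrow> 'a"

definition sub_op :: "('k::field, 'a) operad \<Rightarrow> nat \<Rightarrow> 'a \<Rightarrow> 'a \<Rightarrow> 'a" where
  "sub_op P n f g = add_op P n f (smult_op P n (- 1) g)"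

definition operad_iso ::
    "('k::field, 'a) operad \<Rightarrow> ('k, 'b) operad \<Rightarrow> (nat \<Rightarrow> 'a \<Rightarrow> 'b) \<Rightarrow> bool" where
  "operad_iso P Q \<phi> \<longleftrightarrow>
     (\<forall>n. bij_betw (\<phi> n) (Ops P n) (Ops Q n)) \<and>
     (\<forall>n. \<forall>f\<in>Ops P n. \<forall>g\<in>Ops P n. \<phi> n (add_op P n f g) = add_op Q n (\<phi> n f) (\<phi> n g)) \<and>
     (\<forall>n c. \<forall>f\<in>Ops P n. \<phi> n (smult_op P n c f) = smult_op Q n c (\<phi> n f)) \<and>
     \<phi> 1 (id_op P) = id_op Q \<and>
     (\<forall>n \<sigma>. \<forall>f\<in>Ops P n. \<sigma> permutes {1..n} \<longrightarrow> \<phi> n (act P n \<sigma> f) = act Q n \<sigma> (\<phi> n f)) \<and>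
     (\<forall>m n. \<forall>i\<in>{1..m}. \<forall>f\<in>Ops P m. \<forall>g\<in>Ops P n.
        \<phi> (m + n - 1) (pcomp P m n i f g) = pcomp Q m n i (\<phi> m f) (\<phi> n g))"

definition operad_isomorphic :: "('k::field, 'a) operad \<Rightarrow> ('k, 'b) operad \<Rightarrow> bool" where
  "operad_isomorphic P Q \<longleftrightarrow> (\<exists>\<phi>. operad_iso P Q \<phi>)"


subsection \<open>Operadic ideals and quotients\<close>

definition operad_ideal :: "('k::field, 'a) operad \<Rightarrow> (nat \<Rightarrow> 'a set) \<Rightarrow> bool" where
  "operad_ideal P I \<longleftrightarrow>
     (\<forall>n. I n \<subseteq> Ops P n \<and> zero_op P n \<in> I n) \<and>
     (\<forall>n. \<forall>f\<in>I n. \<forall>g\<in>I n. add_op P n f g \<in> I n) \<and>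
     (\<forall>n c. \<forall>f\<in>I n. smult_op P n c f \<in> I n) \<and>
     (\<forall>n \<sigma>. \<forall>f\<in>I n. \<sigma> permutes {1..n} \<longrightarrow> act P n \<sigma> f \<in> I n) \<and>
     (\<forall>m n. \<forall>i\<in>{1..m}. \<forall>f\<in>I m. \<forall>g\<in>Ops P n. pcomp P m n i f g \<in> I (m + n - 1)) \<and>
     (\<forall>m n. \<forall>i\<in>{1..m}. \<forall>f\<in>Ops P m. \<forall>g\<in>I n. pcomp P m n i f g \<in> I (m + n - 1))"

definition generated_ideal :: "('k::field, 'a) operad \<Rightarrow> (nat \<Rightarrow> 'a set) \<Rightarrow> nat \<Rightarrow> 'a set" where
  "generated_ideal P R n = \<Inter> {I n | I. operad_ideal P I \<and> (\<forall>m. R m \<subseteq> I m)}"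

definition op_coset :: "('k::field, 'a) operad \<Rightarrow> (nat \<Rightarrow> 'a set) \<Rightarrow> nat \<Rightarrow> 'a \<Rightarrow> 'a set" where
  "op_coset P I n f = {add_op P n f h | h. h \<in> I n}"

text \<open>
  The structure on the cosets of an ideal is given by unions over all representatives, all of
  which yield one and the same coset.
\<close>

definition quotient_operad ::
    "('k::field, 'a) operad \<Rightarrow> (nat \<Rightarrow> 'a set) \<Rightarrow> ('k, 'a set) operad" where
  "quotient_operad P I =
     \<lparr> Ops = (\<lambda>n. op_coset P I n ` Ops P n),
       zero_op = (\<lambda>n. op_coset P I n (zero_op P n)),
       add_op = (\<lambda>n A B. \<Union>f\<in>A. \<Union>g\<in>B. op_coset P I n (add_op P n f g)),
       smult_op = (\<lambda>n c A. \<Union>f\<in>A. op_coset P I n (smult_op P n c f)),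
       id_op = op_coset P I 1 (id_op P),
       act = (\<lambda>n \<sigma> A. \<Union>f\<in>A. op_coset P I n (act P n \<sigma> f)),
       pcomp = (\<lambda>m n i A B. \<Union>f\<in>A. \<Union>g\<in>B. op_coset P I (m + n - 1) (pcomp P m n i f g)) \<rparr>"


section \<open>Free operads on binary operations\<close>

text \<open>
  \<open>Op g s t\<close> is the result of applying the binary operation \<open>g\<close> to \<open>s\<close> and \<open>t\<close>, and \<open>Var i\<close> is
  the variable \<open>x\<^sub>i\<close>.
\<close>

datatype 'g monomial = Var nat | Op 'g "'g monomial" "'g monomial"

fun vars :: "'g monomial \<Rightarrow> nat list" where
  "vars (Var i) = [i]"
| "vars (Op g s t) = vars s @ vars t"

definition multilinear :: "nat \<Rightarrow> 'g monomial \<Rightarrow> bool" where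
  "multilinear n t \<longleftrightarrow> distinct (vars t) \<and> set (vars t) = {1..n}"

fun rename :: "(nat \<Rightarrow> nat) \<Rightarrow> 'g monomial \<Rightarrow> 'g monomial" where
  "rename \<sigma> (Var i) = Var (\<sigma> i)"
| "rename \<sigma> (Op g s t) = Op g (rename \<sigma> s) (rename \<sigma> t)"

text \<open>
  \<open>graft n i s t\<close> is \<open>s \<circ>\<^sub>i t\<close> for \<open>t\<close> of arity \<open>n\<close>, that is,
  \<open>s(x\<^sub>1, \<dots>, x\<^bsub>i-1\<^esub>, t(x\<^sub>i, \<dots>, x\<^bsub>i+n-1\<^esub>), x\<^bsub>i+n\<^esub>, \<dots>)\<close>.
\<close>

fun graft :: "nat \<Rightarrow> nat \<Rightarrow> 'g monomial \<Rightarrow> 'g monomial \<Rightarrow> 'g monomial" where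
  "graft n i (Var j) t =
     (if j < i then Var j else if j = i then rename (\<lambda>k. k + i - 1) t else Var (j + n - 1))"
| "graft n i (Op g r s) t = Op g (graft n i r t) (graft n i s t)"

definition pm_scale :: "'k::field \<Rightarrow> ('x \<Rightarrow>\<^sub>0 'k) \<Rightarrow> ('x \<Rightarrow>\<^sub>0 'k)" where
  "pm_scale c p = Poly_Mapping.map ((*) c) p"

lemma lookup_pm_scale [simp]: "Poly_Mapping.lookup (pm_scale c p) x = c * Poly_Mapping.lookup p x"
  by (simp add: pm_scale_def Poly_Mapping.map.rep_eq when_def)

interpretation pm: vector_space "pm_scale :: 'k::field \<Rightarrow> ('x \<Rightarrow>\<^sub>0 'k) \<Rightarrow> ('x \<Rightarrow>\<^sub>0 'k)"
  by unfold_locales (auto intro!: poly_mapping_eqI simp: lookup_add algebra_simps)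

abbreviation mon :: "'x \<Rightarrow> 'x \<Rightarrow>\<^sub>0 'k::field" where
  "mon t \<equiv> Poly_Mapping.single t 1"

text \<open>
  The operations \<open>g :: 'g\<close> have no symmetry: the \<open>S\<^sub>2\<close>-module of generators is the free
  \<open>k[S\<^sub>2]\<close>-module on \<open>'g\<close>, with basis the elements \<open>g(x\<^sub>1, x\<^sub>2)\<close> and \<open>(12) g = g(x\<^sub>2, x\<^sub>1)\<close>.
  The free symmetric operad on such a module consists of the multilinear nonassociative
  polynomials, with substitution as composition and \<open>S\<^sub>n\<close> acting by permuting variables.
\<close>

definition free_operad :: "('k::field, 'g monomial \<Rightarrow>\<^sub>0 'k) operad" where
  "free_operad =
     \<lparr> Ops = (\<lambda>n. {p. \<forall>t\<in>Poly_Mapping.keys p. multilinear n t}),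
       zero_op = (\<lambda>n. 0),
       add_op = (\<lambda>n p q. p + q),
       smult_op = (\<lambda>n c p. pm_scale c p),
       id_op = mon (Var 1),
       act = (\<lambda>n \<sigma> p. \<Sum>t\<in>Poly_Mapping.keys p.
                  Poly_Mapping.single (rename \<sigma> t) (Poly_Mapping.lookup p t)),
       pcomp = (\<lambda>m n i p q. \<Sum>s\<in>Poly_Mapping.keys p. \<Sum>t\<in>Poly_Mapping.keys q.
                  Poly_Mapping.single (graft n i s t)
                    (Poly_Mapping.lookup p s * Poly_Mapping.lookup q t)) \<rparr>"

definition quadratic_ideal :: "('g monomial \<Rightarrow>\<^sub>0 'k::field) set \<Rightarrow> nat \<Rightarrow> ('g monomial \<Rightarrow>\<^sub>0 'k) set" where
  "quadratic_ideal R = generated_ideal free_operad (\<lambda>n. if n = 3 then R else {})"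

text \<open>The binary quadratic operad with space of relations spanned, as an \<open>S\<^sub>3\<close>-module, by
  \<open>R \<subseteq> Ops free_operad 3\<close>.\<close>

definition quadratic_operad ::
    "('g monomial \<Rightarrow>\<^sub>0 'k::field) set \<Rightarrow> ('k, ('g monomial \<Rightarrow>\<^sub>0 'k) set) operad" where
  "quadratic_operad R = quotient_operad free_operad (quadratic_ideal R)"

definition quadratic_class ::
    "('g monomial \<Rightarrow>\<^sub>0 'k::field) set \<Rightarrow> nat \<Rightarrow> ('g monomial \<Rightarrow>\<^sub>0 'k) \<Rightarrow> ('g monomial \<Rightarrow>\<^sub>0 'k) set" where
  "quadratic_class R n p = op_coset free_operad (quadratic_ideal R) n p"

text \<open>
  The value of a monomial in an operad \<open>P\<close>, with \<open>gen g \<in> Ops P 2\<close> substituted for each \<open>g\<close>.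
  \<open>eval_planar\<close> ignores the variables, reading them as \<open>x\<^sub>1, x\<^sub>2, \<dots>\<close> from left to right;
  \<open>op_eval\<close> then permutes them into place.
\<close>

fun eval_planar :: "('k, 'a) operad \<Rightarrow> ('g \<Rightarrow> 'a) \<Rightarrow> 'g monomial \<Rightarrow> 'a" where
  "eval_planar P gen (Var i) = id_op P"
| "eval_planar P gen (Op g s t) =
     (let m = length (vars s); n = length (vars t) in
      pcomp P (n + 1) m 1 (pcomp P 2 n 2 (gen g) (eval_planar P gen t)) (eval_planar P gen s))"

definition op_eval :: "('k, 'a) operad \<Rightarrow> ('g \<Rightarrow> 'a) \<Rightarrow> nat \<Rightarrow> 'g monomial \<Rightarrow> 'a" where
  "op_eval P gen n t =
     act P n (\<lambda>j. if j \<in> {1..n} then vars t ! (j - 1) else j) (eval_planar P gen t)"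


section \<open>The white Manin product with As\<close>

text \<open>
  For vector spaces \<open>Ops P n\<close> and \<open>Ops Q n\<close>, the tensor product is the free vector space on pairs
  modulo the span of the bilinearity relators.
\<close>

definition bilinear_relators ::
    "('k::field, 'a) operad \<Rightarrow> ('k, 'b) operad \<Rightarrow> nat \<Rightarrow> ('a \<times> 'b \<Rightarrow>\<^sub>0 'k) set" where
  "bilinear_relators P Q n =
     {mon (add_op P n f f', g) - mon (f, g) - mon (f', g) | f f' g.
        f \<in> Ops P n \<and> f' \<in> Ops P n \<and> g \<in> Ops Q n} \<union>
     {mon (f, add_op Q n g g') - mon (f, g) - mon (f, g') | f g g'.
        f \<in> Ops P n \<and> g \<in> Ops Q n \<and> g' \<in> Ops Q n} \<union>
     {mon (smult_op P n c f, g) - pm_scale c (mon (f, g)) | c f g.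
        f \<in> Ops P n \<and> g \<in> Ops Q n} \<union>
     {mon (f, smult_op Q n c g) - pm_scale c (mon (f, g)) | c f g.
        f \<in> Ops P n \<and> g \<in> Ops Q n}"

definition zero_in_tensor ::
    "('k::field, 'a) operad \<Rightarrow> ('k, 'b) operad \<Rightarrow> nat \<Rightarrow> ('a \<times> 'b \<Rightarrow>\<^sub>0 'k) \<Rightarrow> bool" where
  "zero_in_tensor P Q n w \<longleftrightarrow> w \<in> pm.span (bilinear_relators P Q n)"

datatype binop = Circ
datatype diop = Prec | Succ

definition circ :: "binop monomial \<Rightarrow> binop monomial \<Rightarrow> binop monomial" (infixl "\<odot>" 75) where
  "s \<odot> t = Op Circ s t"

definition As_relations :: "(binop monomial \<Rightarrow>\<^sub>0 'k::field) set" where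
  "As_relations = {mon ((Var 1 \<odot> Var 2) \<odot> Var 3) - mon (Var 1 \<odot> (Var 2 \<odot> Var 3))}"

definition As :: "('k::field, (binop monomial \<Rightarrow>\<^sub>0 'k) set) operad" where
  "As = quadratic_operad As_relations"

text \<open>
  The module \<open>As(2) \<otimes> V\<close> is free over \<open>k[S\<^sub>2]\<close> on
  \<open>h\<^sub>1 = x\<^sub>1 \<prec> x\<^sub>2 = x\<^sub>1x\<^sub>2 \<otimes> (x\<^sub>1 \<circ> x\<^sub>2)\<close> and \<open>g\<^sub>1 = x\<^sub>1 \<succ> x\<^sub>2 = x\<^sub>1x\<^sub>2 \<otimes> (x\<^sub>2 \<circ> x\<^sub>1)\<close>,
  so the free operad on it is \<open>free_operad\<close> over the operations \<open>Prec\<close>, \<open>Succ\<close>.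
  The next two functions give the tensor factors of \<open>h\<^sub>1\<close> and \<open>g\<^sub>1\<close> in \<open>As(2)\<close> and in \<open>P(2)\<close>
  for the operad \<open>P\<close> with relations \<open>R\<close>.
\<close>

definition As_factor :: "diop \<Rightarrow> (binop monomial \<Rightarrow>\<^sub>0 'k::field) set" where
  "As_factor g = quadratic_class As_relations 2 (mon (Var 1 \<odot> Var 2))"

definition P_factor ::
    "(binop monomial \<Rightarrow>\<^sub>0 'k::field) set \<Rightarrow> diop \<Rightarrow> (binop monomial \<Rightarrow>\<^sub>0 'k) set" where
  "P_factor R g = quadratic_class R 2
     (case g of Prec \<Rightarrow> mon (Var 1 \<odot> Var 2) | Succ \<Rightarrow> mon (Var 2 \<odot> Var 1))"

text \<open>
  The natural map \<open>\<F>(3) \<rightarrow> As(3) \<otimes> P(3)\<close>.  Since the generators \<open>h\<^sub>1, g\<^sub>1\<close> are pure tensors and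
  composition in the target is componentwise, a monomial is sent to the pure tensor of its
  values in \<open>As\<close> and in \<open>P\<close>.
\<close>

definition white_map ::
    "(binop monomial \<Rightarrow>\<^sub>0 'k::field) set \<Rightarrow> (diop monomial \<Rightarrow>\<^sub>0 'k) \<Rightarrow>
     ((binop monomial \<Rightarrow>\<^sub>0 'k) set \<times> (binop monomial \<Rightarrow>\<^sub>0 'k) set \<Rightarrow>\<^sub>0 'k)" where
  "white_map R p = (\<Sum>t\<in>Poly_Mapping.keys p.
     Poly_Mapping.single
       (op_eval As As_factor 3 t, op_eval (quadratic_operad R) (P_factor R) 3 t)
       (Poly_Mapping.lookup p t))"

definition white_relations ::
    "(binop monomial \<Rightarrow>\<^sub>0 'k::field) set \<Rightarrow> (diop monomial \<Rightarrow>\<^sub>0 'k) set" where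
  "white_relations R =
     {p \<in> Ops free_operad 3. zero_in_tensor As (quadratic_operad R) 3 (white_map R p)}"

definition As_white_product ::
    "(binop monomial \<Rightarrow>\<^sub>0 'k::field) set \<Rightarrow> ('k, (diop monomial \<Rightarrow>\<^sub>0 'k) set) operad" where
  "As_white_product R = quadratic_operad (white_relations R)"


section \<open>Nonsymmetric versions\<close>

definition h1 :: "diop monomial \<Rightarrow>\<^sub>0 'k::field" where "h1 = mon (Op Prec (Var 1) (Var 2))"
definition h2 :: "diop monomial \<Rightarrow>\<^sub>0 'k::field" where "h2 = mon (Op Prec (Var 2) (Var 1))"
definition g1 :: "diop monomial \<Rightarrow>\<^sub>0 'k::field" where "g1 = mon (Op Succ (Var 1) (Var 2))"
definition g2 :: "diop monomial \<Rightarrow>\<^sub>0 'k::field" where "g2 = mon (Op Succ (Var 2) (Var 1))"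

definition identification_relations ::
    "(binop monomial \<Rightarrow>\<^sub>0 'k::field) set \<Rightarrow> nat \<Rightarrow> (diop monomial \<Rightarrow>\<^sub>0 'k) set set" where
  "identification_relations R n =
     (let cls = quadratic_class (white_relations R) 2; sub = sub_op (As_white_product R) 2
      in if n = 2 then {sub (cls g1) (cls h2), sub (cls g2) (cls h1)} else {})"

text \<open>
  The property of the binary quadratic operad with one generating operation without symmetry
  (that is, \<open>V\<close> has basis \<open>e\<^sub>1 = x\<^sub>1 \<circ> x\<^sub>2\<close>, \<open>e\<^sub>2 = x\<^sub>2 \<circ> x\<^sub>1\<close>) and relations \<open>R\<close>.
\<close>

definition admits_nonsymmetric_version :: "(binop monomial \<Rightarrow>\<^sub>0 'k::field) set \<Rightarrow> bool" where
  "admits_nonsymmetric_version R \<longleftrightarrow>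
     operad_isomorphic
       (quotient_operad (As_white_product R)
          (generated_ideal (As_white_product R) (identification_relations R)))
       (quadratic_operad R)"

definition Leib_relations :: "(binop monomial \<Rightarrow>\<^sub>0 'k::field) set" where
  "Leib_relations =
     {mon ((Var 1 \<odot> Var 2) \<odot> Var 3) - mon (Var 1 \<odot> (Var 2 \<odot> Var 3))
      + mon (Var 2 \<odot> (Var 1 \<odot> Var 3))}"

end

theory Submission
  imports Defs
begin

text \<open>
  The operad \<open>Q = (As \<circ> Leib)/(g\<^sub>1 - h\<^sub>2, g\<^sub>2 - h\<^sub>1)\<close> has the single relation \<open>(x y) z + (y x) z = 0\<close>,
  so every algebra with \<open>(x y) z = 0\<close> is an algebra over \<open>Q\<close>.  An isomorphism \<open>Q \<cong> Leib\<close> provides an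
  operation \<open>\<nu>\<close> generating \<open>Q\<close> that satisfies the Leibniz identity.  On such an algebra
  \<open>\<nu>(x, y) = \<alpha> x y + \<beta> y x\<close>, and the coefficients of \<open>x\<^sub>1 (x\<^sub>2 x\<^sub>3)\<close> and \<open>x\<^sub>3 (x\<^sub>2 x\<^sub>1)\<close> in the Leibniz
  identity are \<open>-\<alpha>\<^sup>2\<close> and \<open>\<beta>\<^sup>2\<close>.  Hence \<open>\<nu>\<close> vanishes on the algebra, and with it all binary
  operations of \<open>Q\<close>, although \<open>x y\<close> need not be zero there.

  The relations of \<open>As \<circ> Leib\<close> are bounded by evaluating them in the tensor product of an associative
  and a Leibniz algebra, both nilpotent of small dimension.
\<close>

section \<open>Linear extension\<close>

definition lin_ext :: "('x \<Rightarrow> 'k::field) \<Rightarrow> ('x \<Rightarrow>\<^sub>0 'k) \<Rightarrow> 'k" where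
  "lin_ext \<phi> p = (\<Sum>x\<in>Poly_Mapping.keys p. Poly_Mapping.lookup p x * \<phi> x)"

lemma lin_ext_superset:
  assumes "finite K" "Poly_Mapping.keys p \<subseteq> K"
  shows "lin_ext \<phi> p = (\<Sum>x\<in>K. Poly_Mapping.lookup p x * \<phi> x)"
  unfolding lin_ext_def using assms
  by (intro sum.mono_neutral_left) (auto simp: in_keys_iff)

lemma lin_ext_cong: "(\<And>t. t \<in> Poly_Mapping.keys p \<Longrightarrow> \<phi> t = \<psi> t) \<Longrightarrow> lin_ext \<phi> p = lin_ext \<psi> p"
  by (simp add: lin_ext_def)

lemma lin_ext_eq_sum:
  assumes "finite T" "\<And>t. t \<in> Poly_Mapping.keys p \<Longrightarrow> t \<notin> T \<Longrightarrow> \<phi> t = 0"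
  shows "lin_ext \<phi> p = (\<Sum>t\<in>T. Poly_Mapping.lookup p t * \<phi> t)"
  unfolding lin_ext_def using assms
  by (intro sum.mono_neutral_cong) (auto simp: in_keys_iff)

lemma lin_ext_nonzeroE:
  assumes "lin_ext \<phi> p \<noteq> 0"
  obtains t where "t \<in> Poly_Mapping.keys p" "\<phi> t \<noteq> 0"
proof -
  obtain t where "t \<in> Poly_Mapping.keys p" "Poly_Mapping.lookup p t * \<phi> t \<noteq> 0"
    using assms unfolding lin_ext_def by (rule sum.not_neutral_contains_not_neutral)
  then show ?thesis using that by auto
qed

lemma lin_ext_add [simp]: "lin_ext \<phi> (p + q) = lin_ext \<phi> p + lin_ext \<phi> q"
proof -
  let ?K = "Poly_Mapping.keys p \<union> Poly_Mapping.keys q"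
  have "lin_ext \<phi> (p + q) = (\<Sum>x\<in>?K. Poly_Mapping.lookup (p + q) x * \<phi> x)"
    by (rule lin_ext_superset) (auto simp: keys_add)
  also have "\<dots> = lin_ext \<phi> p + lin_ext \<phi> q"
    by (simp add: lin_ext_superset[of ?K] lookup_add distrib_right sum.distrib)
  finally show ?thesis .
qed

lemma lin_ext_zero [simp]: "lin_ext \<phi> 0 = 0"
  by (simp add: lin_ext_def)

lemma lin_ext_scale [simp]: "lin_ext \<phi> (pm_scale c p) = c * lin_ext \<phi> p"
proof -
  have "lin_ext \<phi> (pm_scale c p) =
      (\<Sum>x\<in>Poly_Mapping.keys p. Poly_Mapping.lookup (pm_scale c p) x * \<phi> x)"
    by (rule lin_ext_superset) (auto simp: in_keys_iff)
  also have "\<dots> = c * lin_ext \<phi> p"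
    by (simp add: lin_ext_def sum_distrib_left mult.assoc)
  finally show ?thesis .
qed

lemma lin_ext_single [simp]: "lin_ext \<phi> (Poly_Mapping.single x c) = c * \<phi> x"
  by (simp add: lin_ext_def)

lemma lin_ext_diff [simp]: "lin_ext \<phi> (p - q) = lin_ext \<phi> p - lin_ext \<phi> q"
  by (metis add_diff_cancel_right' diff_add_cancel lin_ext_add)

lemma lin_ext_sum [simp]: "lin_ext \<phi> (\<Sum>a\<in>A. f a) = (\<Sum>a\<in>A. lin_ext \<phi> (f a))"
  by (induction A rule: infinite_finite_induct) auto

lemma lin_ext_span_eq_0:
  assumes "w \<in> pm.span B" "\<And>b. b \<in> B \<Longrightarrow> lin_ext \<phi> b = 0"
  shows "lin_ext \<phi> w = 0"
  using assms(1) by (induction rule: pm.span_induct_alt) (auto simp: assms(2))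

text \<open>A coefficient is itself a linear functional. Together with \<open>lin_ext_act\<close>
  and \<open>lin_ext_pcomp\<close>, which pull a functional back along the action and the
  composition, this gives the coefficients of images and composites without unfolding the sums that
  define them.\<close>

lemma lookup_eq_lin_ext:
  "Poly_Mapping.lookup p u = lin_ext (\<lambda>t. if t = u then 1 else 0) p"
  by (auto simp: lin_ext_def if_distrib sum.delta in_keys_iff cong: if_cong)

lemma lin_ext_act:
  "lin_ext \<phi> (act free_operad n \<sigma> p) = lin_ext (\<lambda>t. \<phi> (rename \<sigma> t)) p"
  by (simp add: free_operad_def) (simp add: lin_ext_def)

lemma lin_ext_pcomp:
  "lin_ext \<phi> (pcomp free_operad m n i p q) =
     lin_ext (\<lambda>s. lin_ext (\<lambda>t. \<phi> (graft n i s t)) q) p"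
  by (simp add: free_operad_def) (simp add: lin_ext_def sum_distrib_left mult.assoc)

lemma lin_ext_fun_add: "lin_ext (\<lambda>x. \<phi> x + \<psi> x) p = lin_ext \<phi> p + lin_ext \<psi> p"
  by (simp add: lin_ext_def distrib_left sum.distrib)


section \<open>Operads with additive structure maps and their quotients\<close>

lemma operad_idealI:
  assumes "\<And>n f. f \<in> I n \<Longrightarrow> f \<in> Ops P n"
    and "\<And>n. zero_op P n \<in> I n"
    and "\<And>n f g. \<lbrakk>f \<in> I n; g \<in> I n\<rbrakk> \<Longrightarrow> add_op P n f g \<in> I n"
    and "\<And>n c f. f \<in> I n \<Longrightarrow> smult_op P n c f \<in> I n"
    and "\<And>n \<sigma> f. \<lbrakk>f \<in> I n; \<sigma> permutes {1..n}\<rbrakk> \<Longrightarrow> act P n \<sigma> f \<in> I n"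
    and "\<And>m n i f g. \<lbrakk>i \<in> {1..m}; f \<in> I m; g \<in> Ops P n\<rbrakk> \<Longrightarrow>
      pcomp P m n i f g \<in> I (m + n - 1)"
    and "\<And>m n i f g. \<lbrakk>i \<in> {1..m}; f \<in> Ops P m; g \<in> I n\<rbrakk> \<Longrightarrow>
      pcomp P m n i f g \<in> I (m + n - 1)"
  shows "operad_ideal P I"
  unfolding operad_ideal_def by (intro conjI allI ballI impI subsetI) (fact assms | simp add: assms)+

context
  fixes P :: "('k::field, 'a) operad" and I
  assumes ideal: "operad_ideal P I"
begin

lemma operad_ideal_closed: "h \<in> I n \<Longrightarrow> h \<in> Ops P n"
  using ideal unfolding operad_ideal_def by (simp add: subset_iff)

lemma operad_ideal_zero: "zero_op P n \<in> I n"
  using ideal unfolding operad_ideal_def by (simp add: subset_iff)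

lemma operad_ideal_add: "\<lbrakk>h \<in> I n; k \<in> I n\<rbrakk> \<Longrightarrow> add_op P n h k \<in> I n"
  using ideal unfolding operad_ideal_def by (simp add: subset_iff)

lemma operad_ideal_smult: "h \<in> I n \<Longrightarrow> smult_op P n c h \<in> I n"
  using ideal unfolding operad_ideal_def by (simp add: subset_iff)

lemma operad_ideal_act: "\<lbrakk>h \<in> I n; \<sigma> permutes {1..n}\<rbrakk> \<Longrightarrow> act P n \<sigma> h \<in> I n"
  using ideal unfolding operad_ideal_def by (simp add: subset_iff)

lemma operad_ideal_pcomp_left:
  "\<lbrakk>i \<in> {1..m}; h \<in> I m; g \<in> Ops P n\<rbrakk> \<Longrightarrow> pcomp P m n i h g \<in> I (m + n - 1)"
  using ideal unfolding operad_ideal_def by (simp add: subset_iff)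

lemma operad_ideal_pcomp_right:
  "\<lbrakk>i \<in> {1..m}; f \<in> Ops P m; h \<in> I n\<rbrakk> \<Longrightarrow> pcomp P m n i f h \<in> I (m + n - 1)"
  using ideal unfolding operad_ideal_def by (simp add: subset_iff)

end

lemma mem_generated_ideal:
  "x \<in> generated_ideal P R n \<longleftrightarrow>
     (\<forall>I. operad_ideal P I \<longrightarrow> (\<forall>m. R m \<subseteq> I m) \<longrightarrow> x \<in> I n)"
  unfolding generated_ideal_def by blast

text \<open>Closure and additivity of the structure maps are what makes the operations on cosets of
  an ideal independent of representatives. These axioms pass to quotients, so the construction can
  be iterated: from the free operad to As o Leib, and from there to its quotient by the
  identifications.\<close>

locale linear_operad =
  fixes P :: "('k::field, 'a) operad"
  assumes zero_closed: "zero_op P n \<in> Ops P n"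
    and add_closed: "\<lbrakk>f \<in> Ops P n; g \<in> Ops P n\<rbrakk> \<Longrightarrow> add_op P n f g \<in> Ops P n"
    and smult_closed: "f \<in> Ops P n \<Longrightarrow> smult_op P n c f \<in> Ops P n"
    and id_closed: "id_op P \<in> Ops P 1"
    and act_closed: "\<lbrakk>f \<in> Ops P n; \<sigma> permutes {1..n}\<rbrakk> \<Longrightarrow> act P n \<sigma> f \<in> Ops P n"
    and pcomp_closed: "\<lbrakk>i \<in> {1..m}; f \<in> Ops P m; g \<in> Ops P n\<rbrakk> \<Longrightarrow>
      pcomp P m n i f g \<in> Ops P (m + n - 1)"
    and add_assoc: "\<lbrakk>f \<in> Ops P n; g \<in> Ops P n; h \<in> Ops P n\<rbrakk> \<Longrightarrow>
      add_op P n (add_op P n f g) h = add_op P n f (add_op P n g h)"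
    and add_comm: "\<lbrakk>f \<in> Ops P n; g \<in> Ops P n\<rbrakk> \<Longrightarrow> add_op P n f g = add_op P n g f"
    and add_zero: "f \<in> Ops P n \<Longrightarrow> add_op P n f (zero_op P n) = f"
    and add_neg: "f \<in> Ops P n \<Longrightarrow> add_op P n f (smult_op P n (- 1) f) = zero_op P n"
    and smult_add: "\<lbrakk>f \<in> Ops P n; g \<in> Ops P n\<rbrakk> \<Longrightarrow>
      smult_op P n c (add_op P n f g) = add_op P n (smult_op P n c f) (smult_op P n c g)"
    and act_add: "\<lbrakk>f \<in> Ops P n; g \<in> Ops P n; \<sigma> permutes {1..n}\<rbrakk> \<Longrightarrow>
      act P n \<sigma> (add_op P n f g) = add_op P n (act P n \<sigma> f) (act P n \<sigma> g)"
    and pcomp_add_left: "\<lbrakk>i \<in> {1..m}; f \<in> Ops P m; f' \<in> Ops P m; g \<in> Ops P n\<rbrakk> \<Longrightarrow>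
      pcomp P m n i (add_op P m f f') g =
        add_op P (m + n - 1) (pcomp P m n i f g) (pcomp P m n i f' g)"
    and pcomp_add_right: "\<lbrakk>i \<in> {1..m}; f \<in> Ops P m; g \<in> Ops P n; g' \<in> Ops P n\<rbrakk> \<Longrightarrow>
      pcomp P m n i f (add_op P n g g') =
        add_op P (m + n - 1) (pcomp P m n i f g) (pcomp P m n i f g')"
begin

lemma operad_ideal_Ops: "operad_ideal P (Ops P)"
  by (intro operad_idealI zero_closed add_closed smult_closed act_closed pcomp_closed)

lemma operad_ideal_generated:
  assumes R: "\<And>n. R n \<subseteq> Ops P n"
  shows "operad_ideal P (generated_ideal P R)"
  \<comment> \<open>\<open>Ops P\<close> is itself an ideal containing \<open>R\<close>, so the
    intersection stays inside \<open>Ops P\<close>.\<close>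
  using operad_ideal_Ops R
  by (intro operad_idealI)
    (simp_all add: mem_generated_ideal operad_ideal_zero operad_ideal_add operad_ideal_smult
      operad_ideal_act operad_ideal_pcomp_left operad_ideal_pcomp_right
      del: One_nat_def)

lemma generated_ideal_incl: "R n \<subseteq> generated_ideal P R n"
  unfolding generated_ideal_def by blast

lemma generated_ideal_least:
  assumes "operad_ideal P I" "\<And>m. R m \<subseteq> I m"
  shows "generated_ideal P R n \<subseteq> I n"
  unfolding generated_ideal_def using assms by blast

end

text \<open>The operations of \<open>quotient_operad\<close> are unions over representatives; such a
  union collapses once all representatives yield one and the same coset.\<close>

lemma UN_const:
  assumes "a \<in> A" "\<And>x. x \<in> A \<Longrightarrow> F x = C"
  shows "(\<Union>x\<in>A. F x) = C"
  using assms by blast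

section \<open>Cosets of an ideal and the quotient operad\<close>

locale linear_operad_ideal = linear_operad P for P :: "('k::field, 'a) operad" +
  fixes I :: "nat \<Rightarrow> 'a set"
  assumes ideal: "operad_ideal P I"
begin

lemmas ideal_Ops = operad_ideal_closed[OF ideal]
  and ideal_zero = operad_ideal_zero[OF ideal]
  and ideal_add = operad_ideal_add[OF ideal]
  and ideal_smult = operad_ideal_smult[OF ideal]
  and ideal_act = operad_ideal_act[OF ideal]
  and ideal_pcomp_left = operad_ideal_pcomp_left[OF ideal]
  and ideal_pcomp_right = operad_ideal_pcomp_right[OF ideal]

abbreviation "cl \<equiv> op_coset P I"

abbreviation "Q \<equiv> quotient_operad P I"

lemma self_in_coset: "f \<in> Ops P n \<Longrightarrow> f \<in> cl n f"
  unfolding op_coset_def using add_zero ideal_zero by force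

lemma coset_add_ideal:
  assumes f: "f \<in> Ops P n" and h: "h \<in> I n"
  shows "cl n (add_op P n f h) = cl n f"
proof
  show "cl n (add_op P n f h) \<subseteq> cl n f"
    unfolding op_coset_def using add_assoc[OF f ideal_Ops[OF h] ideal_Ops] ideal_add[OF h] by auto
  show "cl n f \<subseteq> cl n (add_op P n f h)"
  proof
    fix x assume "x \<in> cl n f"
    then obtain k where k: "k \<in> I n" "x = add_op P n f k" unfolding op_coset_def by blast
    \<comment> \<open>A shift by \<open>h\<close> is undone inside the ideal: f + k = (f + h) + (-h
      + k).\<close>
    let ?h' = "smult_op P n (- 1) h"
    have h': "?h' \<in> I n" using h by (rule ideal_smult)
    note [simp] = ideal_Ops[OF h] ideal_Ops[OF k(1)] ideal_Ops[OF h'] f add_closed zero_closed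
    have "add_op P n h (add_op P n ?h' k) = add_op P n (zero_op P n) k"
      by (simp add: add_assoc[symmetric] add_neg)
    also have "\<dots> = k" by (simp add: add_comm[of "zero_op P n"] add_zero)
    finally have "x = add_op P n (add_op P n f h) (add_op P n ?h' k)"
      using k by (simp add: add_assoc)
    then show "x \<in> cl n (add_op P n f h)"
      unfolding op_coset_def using ideal_add[OF h' k(1)] by blast
  qed
qed

lemma coset_ideal: "h \<in> I n \<Longrightarrow> cl n h = cl n (zero_op P n)"
  using coset_add_ideal[of "zero_op P n" n h] add_comm[of "zero_op P n" n h] add_zero[of h n]
  by (simp add: zero_closed ideal_Ops)

lemma coset_mem_eq: "\<lbrakk>f \<in> Ops P n; f' \<in> cl n f\<rbrakk> \<Longrightarrow> \<exists>h\<in>I n. f' = add_op P n f h"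
  unfolding op_coset_def by blast

lemma quotient_Ops: "Ops Q n = cl n ` Ops P n"
  and quotient_zero: "zero_op Q n = cl n (zero_op P n)"
  and quotient_id: "id_op Q = cl 1 (id_op P)"
  by (simp_all add: quotient_operad_def)

lemma quotient_add:
  assumes f: "f \<in> Ops P n" and g: "g \<in> Ops P n"
  shows "add_op Q n (cl n f) (cl n g) = cl n (add_op P n f g)"
proof -
  have "cl n (add_op P n f' g') = cl n (add_op P n f g)"
    if f': "f' \<in> cl n f" and g': "g' \<in> cl n g" for f' g'
  proof -
    obtain h k where h: "h \<in> I n" "f' = add_op P n f h" and k: "k \<in> I n" "g' = add_op P n g k"
      using coset_mem_eq[OF f f'] coset_mem_eq[OF g g'] by blast
    note [simp] = f g ideal_Ops[OF h(1)] ideal_Ops[OF k(1)] add_closed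
    have "add_op P n f' g' = add_op P n f (add_op P n (add_op P n h g) k)"
      using h k by (simp add: add_assoc)
    also have "\<dots> = add_op P n (add_op P n (add_op P n f g) h) k"
      by (simp add: add_assoc add_comm[of h])
    finally show ?thesis using h k by (simp add: coset_add_ideal)
  qed
  then show ?thesis
    unfolding quotient_operad_def operad.simps
    by (intro UN_const[OF self_in_coset[OF f]] UN_const[OF self_in_coset[OF g]])
qed

lemma quotient_smult:
  assumes f: "f \<in> Ops P n"
  shows "smult_op Q n c (cl n f) = cl n (smult_op P n c f)"
proof -
  have "cl n (smult_op P n c f') = cl n (smult_op P n c f)" if f': "f' \<in> cl n f" for f'
    using coset_mem_eq[OF f f'] f
    by (auto simp: smult_add ideal_Ops smult_closed ideal_smult coset_add_ideal)
  then show ?thesis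
    unfolding quotient_operad_def operad.simps by (intro UN_const[OF self_in_coset[OF f]])
qed

lemma quotient_act:
  assumes f: "f \<in> Ops P n" and s: "\<sigma> permutes {1..n}"
  shows "act Q n \<sigma> (cl n f) = cl n (act P n \<sigma> f)"
proof -
  have "cl n (act P n \<sigma> f') = cl n (act P n \<sigma> f)" if f': "f' \<in> cl n f" for f'
    using coset_mem_eq[OF f f'] f s
    by (auto simp: act_add ideal_Ops act_closed ideal_act coset_add_ideal)
  then show ?thesis
    unfolding quotient_operad_def operad.simps by (intro UN_const[OF self_in_coset[OF f]])
qed

lemma quotient_pcomp:
  assumes i: "i \<in> {1..m}" and f: "f \<in> Ops P m" and g: "g \<in> Ops P n"
  shows "pcomp Q m n i (cl m f) (cl n g) = cl (m + n - 1) (pcomp P m n i f g)"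
proof -
  have "cl (m + n - 1) (pcomp P m n i f' g') = cl (m + n - 1) (pcomp P m n i f g)"
    if f': "f' \<in> cl m f" and g': "g' \<in> cl n g" for f' g'
  proof -
    obtain h k where h: "h \<in> I m" "f' = add_op P m f h" and k: "k \<in> I n" "g' = add_op P n g k"
      using coset_mem_eq[OF f f'] coset_mem_eq[OF g g'] by blast
    have gk: "add_op P n g k \<in> Ops P n" using g k by (simp add: add_closed ideal_Ops)
    \<comment> \<open>Expanding f + h on the left while keeping g' = g + k whole leaves two error
      terms, f composed with k and h composed with g', and both lie in the ideal.\<close>
    have "pcomp P m n i f' g' = add_op P (m + n - 1)
        (add_op P (m + n - 1) (pcomp P m n i f g) (pcomp P m n i f k)) (pcomp P m n i h g')"
      using h k i f g gk by (simp add: pcomp_add_left pcomp_add_right ideal_Ops)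
    then show ?thesis
      using i f g h k gk
      by (simp add: coset_add_ideal add_closed pcomp_closed ideal_Ops ideal_pcomp_left
          ideal_pcomp_right del: One_nat_def)
  qed
  then show ?thesis
    unfolding quotient_operad_def operad.simps
    by (intro UN_const[OF self_in_coset[OF f]] UN_const[OF self_in_coset[OF g]])
qed

lemmas quotient_simps =
  quotient_add quotient_smult quotient_act quotient_pcomp quotient_zero quotient_id

lemma linear_operad_quotient: "linear_operad Q"
proof (unfold_locales, goal_cases)
  case 1 then show ?case by (simp add: quotient_Ops quotient_simps zero_closed)
next
  case 2 then show ?case by (auto simp: quotient_Ops quotient_simps add_closed)
next
  case 3 then show ?case by (auto simp: quotient_Ops quotient_simps smult_closed)
next
  case 4 then show ?case by (simp add: quotient_Ops quotient_simps id_closed del: One_nat_def)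
next
  case 5 then show ?case by (auto simp: quotient_Ops quotient_simps act_closed)
next
  case 6 then show ?case
    by (auto simp: quotient_Ops quotient_simps pcomp_closed simp del: One_nat_def)
next
  case 7 then show ?case by (auto simp: quotient_Ops quotient_simps add_closed add_assoc)
next
  case 8 then show ?case by (auto simp: quotient_Ops quotient_simps add_comm)
next
  case 9 then show ?case by (auto simp: quotient_Ops quotient_simps zero_closed add_zero)
next
  case 10 then show ?case by (auto simp: quotient_Ops quotient_simps smult_closed add_neg)
next
  case 11 then show ?case
    by (auto simp: quotient_Ops quotient_simps add_closed smult_closed smult_add)
next
  case 12 then show ?case
    by (auto simp: quotient_Ops quotient_simps add_closed act_closed act_add)
next
  case 13 then show ?case
    by (auto simp: quotient_Ops quotient_simps add_closed pcomp_closed pcomp_add_left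
        simp del: One_nat_def)
next
  case 14 then show ?case
    by (auto simp: quotient_Ops quotient_simps add_closed pcomp_closed pcomp_add_right
        simp del: One_nat_def)
qed

end


section \<open>Evaluation of operads in algebras\<close>

text \<open>Partial composition in the endomorphism operad: applying F to
  \<open>subst_arg n i G v\<close> is applying F composed at i with G to \<open>v\<close>. Inputs
  are numbered from 1, so the first input of G is \<open>v i\<close>.\<close>

definition subst_arg ::
    "nat \<Rightarrow> nat \<Rightarrow> ((nat \<Rightarrow> 'x) \<Rightarrow> 'x) \<Rightarrow> (nat \<Rightarrow> 'x) \<Rightarrow> nat \<Rightarrow> 'x" where
  "subst_arg n i G v =
     (\<lambda>j. if j < i then v j else if j = i then G (\<lambda>k. v (k + i - 1)) else v (j + n - 1))"

lemma subst_arg_simps: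
  "subst_arg n 1 G v 1 = G v"
  "subst_arg n 1 G v 2 = v (n + 1)"
  "subst_arg n 2 G v 1 = v 1"
  "subst_arg n 2 G v 2 = G (\<lambda>k. v (k + 1))"
proof -
  have "k + 2 - 1 = k + 1" for k :: nat by simp
  then show "subst_arg n 2 G v 2 = G (\<lambda>k. v (k + 1))" by (simp add: subst_arg_def)
qed (simp_all add: subst_arg_def numeral_2_eq_2)

text \<open>A homomorphism from \<open>P\<close> to the endomorphism operad of the vector space \<open>'b \<Rightarrow> 'k\<close>;
  of multilinearity in the target only the consequence needed for kernels is recorded.\<close>

locale operad_evaluation = linear_operad P for P :: "('k::field, 'a) operad" +
  fixes E :: "nat \<Rightarrow> 'a \<Rightarrow> (nat \<Rightarrow> 'b \<Rightarrow> 'k) \<Rightarrow> 'b \<Rightarrow> 'k"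
  assumes eval_add: "\<lbrakk>f \<in> Ops P n; g \<in> Ops P n\<rbrakk> \<Longrightarrow>
      E n (add_op P n f g) v x = E n f v x + E n g v x"
    and eval_zero: "E n (zero_op P n) v x = 0"
    and eval_smult: "f \<in> Ops P n \<Longrightarrow> E n (smult_op P n c f) v x = c * E n f v x"
    and eval_id: "E 1 (id_op P) v = v 1"
    and eval_act: "\<lbrakk>f \<in> Ops P n; \<sigma> permutes {1..n}\<rbrakk> \<Longrightarrow>
      E n (act P n \<sigma> f) v = E n f (v \<circ> \<sigma>)"
    and eval_pcomp: "\<lbrakk>i \<in> {1..m}; f \<in> Ops P m; g \<in> Ops P n\<rbrakk> \<Longrightarrow>
      E (m + n - 1) (pcomp P m n i f g) v = E m f (subst_arg n i (E n g) v)"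
    and eval_zero_arg: "\<lbrakk>f \<in> Ops P n; i \<in> {1..n}; v i = (\<lambda>_. 0)\<rbrakk> \<Longrightarrow> E n f v x = 0"
begin

definition identities :: "nat \<Rightarrow> 'a set" where
  "identities n = {f \<in> Ops P n. \<forall>v x. E n f v x = 0}"

text \<open>If the inner operation of a composite vanishes identically, the outer one receives the
  zero vector in slot i; this is where \<open>eval_zero_arg\<close> stands in for
  multilinearity.\<close>

lemma operad_ideal_identities: "operad_ideal P identities"
proof -
  have "E (m + n - 1) (pcomp P m n i f g) v x = 0"
    if "i \<in> {1..m}" "f \<in> Ops P m" "g \<in> identities n" for m n i f g v x
  proof -
    have "E n g w = (\<lambda>_. 0)" for w
      using that by (auto simp: identities_def)
    then show ?thesis
      using that by (simp only: eval_pcomp identities_def mem_Collect_eq)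
        (rule eval_zero_arg[of _ _ i], auto simp: subst_arg_def)
  qed
  moreover have "E (m + n - 1) (pcomp P m n i f g) v x = 0"
    if "i \<in> {1..m}" "f \<in> identities m" "g \<in> Ops P n" for m n i f g v x
    using that eval_pcomp[of i m f g n] by (simp add: identities_def)
  ultimately show ?thesis
    by (intro operad_idealI)
      (simp_all add: identities_def zero_closed add_closed smult_closed act_closed
        pcomp_closed[simplified] eval_zero eval_add eval_smult eval_act)
qed

lemma generated_ideal_identities:
  assumes "\<And>n. R n \<subseteq> identities n"
  shows "linear_operad_ideal P (generated_ideal P R)"
    and "generated_ideal P R n \<subseteq> identities n"
proof -
  show "linear_operad_ideal P (generated_ideal P R)"
    by unfold_locales
      (rule operad_ideal_generated, use assms in \<open>auto simp: identities_def\<close>)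
  show "generated_ideal P R n \<subseteq> identities n"
    by (rule generated_ideal_least[OF operad_ideal_identities assms])
qed

end

text \<open>The representative is arbitrary; \<open>quotient_eval_coset\<close> shows that the
  choice does not matter when the ideal consists of identities of the algebra.\<close>

definition quotient_eval ::
    "(nat \<Rightarrow> 'a \<Rightarrow> (nat \<Rightarrow> 'b \<Rightarrow> 'k) \<Rightarrow> 'b \<Rightarrow> 'k) \<Rightarrow>
     nat \<Rightarrow> 'a set \<Rightarrow> (nat \<Rightarrow> 'b \<Rightarrow> 'k) \<Rightarrow> 'b \<Rightarrow> 'k" where
  "quotient_eval E n X = E n (SOME f. f \<in> X)"

locale operad_evaluation_ideal =
  operad_evaluation P E + linear_operad_ideal P I
  for P :: "('k::field, 'a) operad"
    and E :: "nat \<Rightarrow> 'a \<Rightarrow> (nat \<Rightarrow> 'b \<Rightarrow> 'k) \<Rightarrow> 'b \<Rightarrow> 'k"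
    and I +
  assumes ideal_identities: "I n \<subseteq> identities n"
begin

lemma quotient_eval_coset:
  assumes f: "f \<in> Ops P n"
  shows "quotient_eval E n (cl n f) = E n f"
proof -
  define g where "g = (SOME g. g \<in> cl n f)"
  have "g \<in> cl n f" unfolding g_def using self_in_coset[OF f] by (rule someI)
  then obtain h where h: "h \<in> I n" "g = add_op P n f h" using coset_mem_eq[OF f] by blast
  then have "\<forall>v x. E n h v x = 0" using ideal_identities by (auto simp: identities_def)
  then have "E n g = E n f" using h f by (intro ext) (simp add: eval_add ideal_Ops)
  then show ?thesis by (simp add: quotient_eval_def g_def)
qed

lemma operad_evaluation_quotient: "operad_evaluation Q (quotient_eval E)"
proof -
  interpret q: linear_operad Q by (rule linear_operad_quotient)
  show ?thesis
  proof (unfold_locales, goal_cases)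
    case 1 then show ?case
      by (auto simp: quotient_Ops quotient_simps quotient_eval_coset add_closed eval_add)
  next
    case 2 then show ?case
      by (simp add: quotient_simps quotient_eval_coset zero_closed eval_zero)
  next
    case 3 then show ?case
      by (auto simp: quotient_Ops quotient_simps quotient_eval_coset smult_closed eval_smult)
  next
    case 4 then show ?case
      using quotient_eval_coset[OF id_closed] eval_id by (simp add: quotient_simps)
  next
    case 5 then show ?case
      by (auto simp: quotient_Ops quotient_simps quotient_eval_coset act_closed eval_act)
  next
    case 6 then show ?case
      by (auto simp: quotient_Ops quotient_simps quotient_eval_coset pcomp_closed eval_pcomp
          simp del: One_nat_def)
  next
    case (7 f n i v x) then show ?case
      using eval_zero_arg[of _ n i v x] by (auto simp: quotient_Ops quotient_eval_coset)
  qed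
qed

end

section \<open>Values of monomials in an operad and in an algebra\<close>

lemma length_vars_pos: "0 < length (vars t)"
  by (induction t) auto

lemma multilinear_length: "multilinear n t \<Longrightarrow> length (vars t) = n"
  unfolding multilinear_def by (metis card_atLeastAtMost diff_Suc_1 distinct_card)

fun tree_eval ::
    "('g \<Rightarrow> 'x \<Rightarrow> 'x \<Rightarrow> 'x) \<Rightarrow> (nat \<Rightarrow> 'x) \<Rightarrow> 'g monomial \<Rightarrow> 'x" where
  "tree_eval \<mu> v (Var i) = v i"
| "tree_eval \<mu> v (Op g s t) = \<mu> g (tree_eval \<mu> v s) (tree_eval \<mu> v t)"

lemma tree_eval_cong:
  "(\<And>i. i \<in> set (vars t) \<Longrightarrow> v i = w i) \<Longrightarrow> tree_eval \<mu> v t = tree_eval \<mu> w t"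
  by (induction t) auto

context operad_evaluation
begin

context
  fixes gen :: "'g \<Rightarrow> 'a" and \<mu> :: "'g \<Rightarrow> ('b \<Rightarrow> 'k) \<Rightarrow> ('b \<Rightarrow> 'k) \<Rightarrow> 'b \<Rightarrow> 'k"
  assumes gen_closed: "\<And>g. gen g \<in> Ops P 2"
    and eval_gen: "\<And>g v. E 2 (gen g) v = \<mu> g (v 1) (v 2)"
begin

lemma eval_planar_closed: "eval_planar P gen t \<in> Ops P (length (vars t))"
proof (induction t)
  case (Var i) then show ?case using id_closed by simp
next
  case (Op g s t)
  let ?m = "length (vars s)" and ?n = "length (vars t)"
  have 1: "pcomp P 2 ?n 2 (gen g) (eval_planar P gen t) \<in> Ops P (?n + 1)"
    using pcomp_closed[of 2 2 "gen g" _ ?n] Op.IH gen_closed by simp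
  show ?case
    using pcomp_closed[of 1 "?n + 1" _ _ ?m, OF _ 1 Op.IH(1)] by (simp add: Let_def add.commute)
qed

text \<open>\<open>eval_planar\<close> knows leaf positions, not variable names. The hypothesis
  therefore matches an assignment \<open>w\<close> of variables with an assignment \<open>v\<close>
  of positions; lists are indexed from 0 and operad inputs from 1, whence
  \<open>j + 1\<close>.\<close>

lemma eval_eval_planar:
  assumes "\<And>j. j < length (vars t) \<Longrightarrow> w (vars t ! j) = v (j + 1)"
  shows "E (length (vars t)) (eval_planar P gen t) v = tree_eval \<mu> w t"
  using assms
proof (induction t arbitrary: v)
  case (Var i) then show ?case using eval_id by simp
next
  case (Op g s t)
  let ?m = "length (vars s)" and ?n = "length (vars t)"
  let ?X = "eval_planar P gen s" and ?Y = "eval_planar P gen t"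
  let ?Z = "pcomp P 2 ?n 2 (gen g) ?Y"
  have Z: "?Z \<in> Ops P (?n + 1)"
    using pcomp_closed[of 2 2 "gen g" _ ?n] eval_planar_closed gen_closed by simp
  have s: "E ?m ?X v = tree_eval \<mu> w s"
  proof (rule Op.IH)
    fix j assume "j < ?m"
    then show "w (vars s ! j) = v (j + 1)"
      using Op.prems[of j] by (simp add: nth_append)
  qed
  have t: "E ?n ?Y (\<lambda>k. v (k + ?m)) = tree_eval \<mu> w t"
  proof (rule Op.IH)
    fix j assume "j < ?n"
    then show "w (vars t ! j) = v (j + 1 + ?m)"
      using Op.prems[of "?m + j"] by (simp add: nth_append add.commute add.left_commute)
  qed
  have "E (?n + 1 + ?m - 1) (pcomp P (?n + 1) ?m 1 ?Z ?X) v =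
      E (?n + 1) ?Z (subst_arg ?m 1 (E ?m ?X) v)"
    by (rule eval_pcomp) (use Z eval_planar_closed in auto)
  also have "\<dots> = E 2 (gen g) (subst_arg ?n 2 (E ?n ?Y) (subst_arg ?m 1 (E ?m ?X) v))"
    using eval_pcomp[of 2 2 "gen g" ?Y ?n] gen_closed eval_planar_closed by simp
  also have "\<dots> = \<mu> g (E ?m ?X v) (E ?n ?Y (\<lambda>k. subst_arg ?m 1 (E ?m ?X) v (k + 1)))"
    by (simp only: eval_gen subst_arg_simps)
  \<comment> \<open>Inserting the left subtree in slot 1 moves input k + 1 of \<open>?Z\<close> to
    position k + \<open>?m\<close>, which is where leaf number k of the right subtree stands in the
    whole tree.\<close>
  also have "E ?n ?Y (\<lambda>k. subst_arg ?m 1 (E ?m ?X) v (k + 1)) = tree_eval \<mu> w t"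
  proof (rule Op.IH)
    fix j assume "j < ?n"
    then show "w (vars t ! j) = subst_arg ?m 1 (E ?m ?X) v (j + 1 + 1)"
      using Op.prems[of "?m + j"] by (simp add: nth_append subst_arg_def add.commute add.left_commute)
  qed
  finally show ?case by (simp add: Let_def s add.commute)
qed

text \<open>The permutation in \<open>op_eval\<close> sends position j to the variable at the j-th
  leaf. Hence the action turns \<open>v\<close> into exactly the assignment of positions that
  \<open>eval_eval_planar\<close> matches with \<open>v\<close> on variables.\<close>

lemma eval_op_eval:
  assumes t: "multilinear n t"
  shows "E n (op_eval P gen n t) v = tree_eval \<mu> v t"
proof -
  note len = multilinear_length[OF t]
  let ?\<sigma> = "\<lambda>j. if j \<in> {1..n} then vars t ! (j - 1) else j"
  have inj: "inj_on ?\<sigma> {1..n}"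
    using t len by (auto simp: inj_on_def multilinear_def nth_eq_iff_index_eq)
  have "?\<sigma> ` {1..n} \<subseteq> {1..n}"
  proof
    fix y assume "y \<in> ?\<sigma> ` {1..n}"
    then obtain j where "j \<in> {1..n}" "y = vars t ! (j - 1)" by auto
    then have "y \<in> set (vars t)" using len by auto
    then show "y \<in> {1..n}" using t by (simp add: multilinear_def)
  qed
  then have "?\<sigma> ` {1..n} = {1..n}" using endo_inj_surj[OF finite_atLeastAtMost _ inj] by blast
  then have "?\<sigma> permutes {1..n}"
    using inj by (intro bij_imp_permutes) (simp_all only: bij_betw_def if_False)
  moreover have "eval_planar P gen t \<in> Ops P n" using eval_planar_closed[of t] len by simp
  ultimately show ?thesis
    unfolding op_eval_def using len eval_eval_planar[of t v "v \<circ> ?\<sigma>"]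
    by (auto simp: eval_act)
qed

end

end


section \<open>The free operad\<close>

lemma vars_rename: "vars (rename \<sigma> t) = map \<sigma> (vars t)"
  by (induction t) auto

lemma multilinear_rename:
  assumes "multilinear n t" "\<sigma> permutes {1..n}"
  shows "multilinear n (rename \<sigma> t)"
  using assms permutes_inj_on[OF assms(2)] permutes_image[OF assms(2)]
  by (auto simp: multilinear_def vars_rename distinct_map)

text \<open>The indices that replace j when a monomial of arity n is grafted at i. For j from 1 to m
  these blocks partition the indices from 1 to m + n - 1, which is why grafting preserves
  multilinearity.\<close>

definition graft_block :: "nat \<Rightarrow> nat \<Rightarrow> nat \<Rightarrow> nat set" where
  "graft_block n i j = (if j < i then {j} else if j = i then {i..i + n - 1} else {j + n - 1})"

lemma graft_block_disjoint:
  "j \<noteq> j' \<Longrightarrow> 1 \<le> n \<Longrightarrow> graft_block n i j \<inter> graft_block n i j' = {}"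
  by (auto simp: graft_block_def)

lemma UN_graft_block:
  assumes "1 \<le> n" "i \<in> {1..m}"
  shows "(\<Union>j\<in>{1..m}. graft_block n i j) = {1..m + n - 1}"
proof (intro equalityI subsetI)
  fix x assume x: "x \<in> {1..m + n - 1}"
  consider "x < i" | "x \<in> {i..i + n - 1}" | "x > i + n - 1" by fastforce
  then show "x \<in> (\<Union>j\<in>{1..m}. graft_block n i j)"
  proof cases
    case 1 then show ?thesis using x assms by (intro UN_I[of x]) (auto simp: graft_block_def)
  next
    case 2 then show ?thesis using x assms by (intro UN_I[of i]) (auto simp: graft_block_def)
  next
    case 3 then show ?thesis using x assms
      by (intro UN_I[of "x + 1 - n"]) (auto simp: graft_block_def)
  qed
qed (use assms in \<open>auto simp: graft_block_def split: if_splits\<close>)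

lemma image_shift_eq: "1 \<le> i \<Longrightarrow> 1 \<le> n \<Longrightarrow> (\<lambda>k. k + i - 1) ` {1..n} = {i..i + n - 1}" for i :: nat
proof (intro equalityI subsetI)
  fix x assume "1 \<le> i" "1 \<le> n" "x \<in> {i..i + n - 1}"
  then show "x \<in> (\<lambda>k. k + i - 1) ` {1..n}" by (intro image_eqI[of _ _ "x + 1 - i"]) auto
qed auto

lemma multilinear_pos: "multilinear n t \<Longrightarrow> 1 \<le> n"
  using length_vars_pos[of t] multilinear_length[of n t] by simp

lemma multilinear_graft:
  assumes s: "multilinear m s" and t: "multilinear n t" and i: "i \<in> {1..m}"
  shows "multilinear (m + n - 1) (graft n i s t)"
proof -
  have n: "1 \<le> n" using t by (rule multilinear_pos)
  have set: "set (vars (graft n i r t)) = (\<Union>j\<in>set (vars r). graft_block n i j)" for r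
    using t i n image_shift_eq[of i n]
    by (induction r) (auto simp: graft_block_def vars_rename multilinear_def)
  have "distinct (vars (graft n i r t))" if "distinct (vars r)" for r
    using that
  proof (induction r)
    case (Var j) then show ?case
      using t i by (auto simp: vars_rename multilinear_def distinct_map inj_on_def)
  next
    case (Op g r r')
    have "graft_block n i j \<inter> graft_block n i j' = {}"
      if "j \<in> set (vars r)" "j' \<in> set (vars r')" for j j'
      using that Op.prems n by (intro graft_block_disjoint) auto
    then show ?case using Op by (simp add: set) blast
  qed
  then show ?thesis using s UN_graft_block[OF n i] by (simp add: multilinear_def set)
qed

lemma lookup_act:
  "Poly_Mapping.lookup (act free_operad n \<sigma> p) u =
     lin_ext (\<lambda>t. if rename \<sigma> t = u then 1 else 0) p"
  by (simp add: lookup_eq_lin_ext lin_ext_act)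

lemma lookup_pcomp:
  "Poly_Mapping.lookup (pcomp free_operad m n i p q) u =
     lin_ext (\<lambda>s. lin_ext (\<lambda>t. if graft n i s t = u then 1 else 0) q) p"
  by (simp add: lookup_eq_lin_ext lin_ext_pcomp)

lemma free_operad_simps [simp]:
  "Ops free_operad n = {p. \<forall>t\<in>Poly_Mapping.keys p. multilinear n t}"
  "zero_op free_operad n = 0"
  "add_op free_operad n p q = p + q"
  "smult_op free_operad n c p = pm_scale c p"
  "id_op free_operad = mon (Var 1)"
  by (simp_all add: free_operad_def)

lemma linear_operad_free: "linear_operad free_operad"
proof (unfold_locales, goal_cases)
  case 2 then show ?case using keys_add by fastforce
next
  case 3 then show ?case by (auto simp: in_keys_iff)
next
  case 4 then show ?case by (simp add: multilinear_def)
next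
  case (5 f n \<sigma>)
  show ?case
  proof (simp only: free_operad_simps, intro CollectI ballI)
    \<comment> \<open>A nonzero coefficient at u forces some key of \<open>f\<close> to be renamed
      to u; the case of composition argues in the same way with two keys.\<close>
    fix u assume "u \<in> Poly_Mapping.keys (act free_operad n \<sigma> f)"
    then have "lin_ext (\<lambda>t. if rename \<sigma> t = u then 1 else 0) f \<noteq> 0"
      by (simp only: in_keys_iff lookup_act not_False_eq_True)
    then show "multilinear n u"
      by (rule lin_ext_nonzeroE) (use 5 multilinear_rename in \<open>auto split: if_splits\<close>)
  qed
next
  case (6 i m f g n)
  show ?case
  proof (simp only: free_operad_simps, intro CollectI ballI)
    fix u assume "u \<in> Poly_Mapping.keys (pcomp free_operad m n i f g)"
    then have "lin_ext (\<lambda>s. lin_ext (\<lambda>t. if graft n i s t = u then 1 else 0) g) f \<noteq> 0"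
      by (simp only: in_keys_iff lookup_pcomp not_False_eq_True)
    then obtain s where s: "s \<in> Poly_Mapping.keys f"
      "lin_ext (\<lambda>t. if graft n i s t = u then 1 else 0) g \<noteq> 0" by (rule lin_ext_nonzeroE)
    from s(2) obtain t where "t \<in> Poly_Mapping.keys g" "graft n i s t = u"
      by (rule lin_ext_nonzeroE) (auto split: if_splits)
    with s(1) 6 show "multilinear (m + n - 1) u" using multilinear_graft by fastforce
  qed
next
  case 10 then show ?case by (intro poly_mapping_eqI) (simp add: lookup_add)
next
  case 11 then show ?case by (simp add: pm.scale_right_distrib)
next
  case 12 then show ?case by (intro poly_mapping_eqI) (simp add: lookup_add lookup_act)
next
  case 13 then show ?case by (intro poly_mapping_eqI) (simp add: lookup_add lookup_pcomp)
next
  case 14 then show ?case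
    by (intro poly_mapping_eqI) (simp add: lookup_add lookup_pcomp lin_ext_fun_add)
qed (simp_all add: ac_simps)

section \<open>Evaluation of the free operad in an algebra\<close>

definition bilinear_ops ::
    "('g \<Rightarrow> ('b \<Rightarrow> 'k) \<Rightarrow> ('b \<Rightarrow> 'k) \<Rightarrow> 'b \<Rightarrow> 'k::field) \<Rightarrow> bool" where
  "bilinear_ops \<mu> \<longleftrightarrow> (\<forall>g a b x y z.
     \<mu> g (\<lambda>i. a * x i + b * y i) z = (\<lambda>i. a * \<mu> g x z i + b * \<mu> g y z i) \<and>
     \<mu> g z (\<lambda>i. a * x i + b * y i) = (\<lambda>i. a * \<mu> g z x i + b * \<mu> g z y i))"

lemma bilinear_ops_sum:
  assumes "bilinear_ops \<mu>" "finite K"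
  shows "\<mu> g (\<lambda>i. \<Sum>t\<in>K. c t * F t i) z = (\<lambda>i. \<Sum>t\<in>K. c t * \<mu> g (F t) z i)"
    and "\<mu> g z (\<lambda>i. \<Sum>t\<in>K. c t * F t i) = (\<lambda>i. \<Sum>t\<in>K. c t * \<mu> g z (F t) i)"
proof -
  have *: "\<mu> g (\<lambda>i. a * x i + b * y i) z = (\<lambda>i. a * \<mu> g x z i + b * \<mu> g y z i)"
    "\<mu> g z (\<lambda>i. a * x i + b * y i) = (\<lambda>i. a * \<mu> g z x i + b * \<mu> g z y i)" for a b x y
    using assms(1) unfolding bilinear_ops_def by blast+
  show "\<mu> g (\<lambda>i. \<Sum>t\<in>K. c t * F t i) z = (\<lambda>i. \<Sum>t\<in>K. c t * \<mu> g (F t) z i)"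
    using assms(2)
  proof induction
    \<comment> \<open>The empty sum is the zero vector, written as 0 z + 0 z.\<close>
    case empty then show ?case using *(1)[of 0 z 0 z] by simp
  next
    case (insert t K) then show ?case
      using *(1)[of "c t" "F t" 1 "\<lambda>i. \<Sum>t\<in>K. c t * F t i"] by simp
  qed
  show "\<mu> g z (\<lambda>i. \<Sum>t\<in>K. c t * F t i) = (\<lambda>i. \<Sum>t\<in>K. c t * \<mu> g z (F t) i)"
    using assms(2)
  proof induction
    case empty then show ?case using *(2)[of 0 z 0 z] by simp
  next
    case (insert t K) then show ?case
      using *(2)[of "c t" "F t" 1 "\<lambda>i. \<Sum>t\<in>K. c t * F t i"] by simp
  qed
qed

text \<open>The variable j occurs in exactly one of the two subtrees, so the sum is pulled out of
  that factor by bilinearity. Sums serve to substitute a polynomial for an argument; the empty sum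
  shows that a zero argument gives zero.\<close>

lemma tree_eval_linear_arg:
  assumes \<mu>: "bilinear_ops \<mu>" "finite K" and s: "distinct (vars s)" "j \<in> set (vars s)"
  shows "tree_eval \<mu> (v(j := \<lambda>x. \<Sum>t\<in>K. c t * F t x)) s =
    (\<lambda>x. \<Sum>t\<in>K. c t * tree_eval \<mu> (v(j := F t)) s x)"
  using s
proof (induction s)
  case (Var i) then show ?case by simp
next
  case (Op g r s)
  have const: "tree_eval \<mu> (v(j := X)) u = tree_eval \<mu> v u" if "j \<notin> set (vars u)" for X u
    using that by (intro tree_eval_cong) auto
  show ?case
  proof (cases "j \<in> set (vars r)")
    case True
    then have "j \<notin> set (vars s)" using Op.prems by auto
    with True Op show ?thesis by (simp add: const bilinear_ops_sum(1)[OF \<mu>] del: fun_upd_apply)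
  next
    case False
    with Op show ?thesis by (simp add: const bilinear_ops_sum(2)[OF \<mu>] del: fun_upd_apply)
  qed
qed

lemma tree_eval_rename: "tree_eval \<mu> v (rename \<sigma> t) = tree_eval \<mu> (v \<circ> \<sigma>) t"
  by (induction t) auto

lemma tree_eval_graft:
  "tree_eval \<mu> v (graft n i s t) = tree_eval \<mu> (subst_arg n i (\<lambda>w. tree_eval \<mu> w t) v) s"
  by (induction s) (auto simp: subst_arg_def tree_eval_rename comp_def)

definition free_eval ::
    "('g \<Rightarrow> ('b \<Rightarrow> 'k) \<Rightarrow> ('b \<Rightarrow> 'k) \<Rightarrow> 'b \<Rightarrow> 'k::field) \<Rightarrow>
     nat \<Rightarrow> ('g monomial \<Rightarrow>\<^sub>0 'k) \<Rightarrow> (nat \<Rightarrow> 'b \<Rightarrow> 'k) \<Rightarrow> 'b \<Rightarrow> 'k" where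
  "free_eval \<mu> n p v = (\<lambda>x. lin_ext (\<lambda>t. tree_eval \<mu> v t x) p)"

lemma operad_evaluation_free:
  assumes \<mu>: "bilinear_ops \<mu>"
  shows "operad_evaluation free_operad (free_eval \<mu>)"
proof -
  interpret linear_operad free_operad by (rule linear_operad_free)
  show ?thesis
  proof (unfold_locales, goal_cases)
    case 5 then show ?case by (simp add: free_eval_def lin_ext_act tree_eval_rename)
  next
    case (6 i m f g n v)
    have "lin_ext (\<lambda>t. tree_eval \<mu> v (graft n i s t) x) g =
        tree_eval \<mu> (subst_arg n i (free_eval \<mu> n g) v) s x"
      if s: "s \<in> Poly_Mapping.keys f" for s x
    proof -
      \<comment> \<open>The placeholder at slot i is overwritten at once; \<open>subst_arg\<close>
        becomes a function update, the form in which linearity in one argument is stated.\<close>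
      define w where "w = subst_arg n i (\<lambda>_. undefined) v"
      have upd: "subst_arg n i G v = w(i := G (\<lambda>k. v (k + i - 1)))" for G
        by (auto simp: w_def subst_arg_def)
      have "distinct (vars s)" "i \<in> set (vars s)" using s 6 by (auto simp: multilinear_def)
      then show ?thesis
        unfolding tree_eval_graft upd free_eval_def lin_ext_def
        by (subst tree_eval_linear_arg[OF \<mu>]) auto
    qed
    then show ?case
      by (simp add: free_eval_def lin_ext_pcomp cong: lin_ext_cong)
  next
    case (7 f n i v x)
    have "tree_eval \<mu> v s x = 0" if "s \<in> Poly_Mapping.keys f" for s
    proof -
      have "distinct (vars s)" "i \<in> set (vars s)" using that 7 by (auto simp: multilinear_def)
      then have "tree_eval \<mu> (v(i := \<lambda>_. 0)) s = (\<lambda>_. 0)"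
        using tree_eval_linear_arg[OF \<mu>, of "{}"] by simp
      moreover have "v(i := \<lambda>_. 0) = v" using 7 by auto
      ultimately show ?thesis by simp
    qed
    then show ?case by (simp add: free_eval_def lin_ext_def)
  qed (simp_all add: free_eval_def)
qed

text \<open>Identities of an algebra form an ideal, so checking the relations in arity 3 suffices in
  all arities. This is applied to As, Leib and As o Leib.\<close>

lemma operad_evaluation_quadratic:
  assumes \<mu>: "bilinear_ops \<mu>" and R: "R \<subseteq> Ops free_operad 3"
    and sat: "\<And>r v x. r \<in> R \<Longrightarrow> free_eval \<mu> 3 r v x = 0"
  shows "operad_evaluation_ideal free_operad (free_eval \<mu>) (quadratic_ideal R)"
proof -
  interpret operad_evaluation free_operad "free_eval \<mu>"
    using \<mu> by (rule operad_evaluation_free)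
  have "(if n = 3 then R else {}) \<subseteq> identities n" for n
    using R sat by (auto simp: identities_def)
  note * = generated_ideal_identities[of "\<lambda>n. if n = 3 then R else {}", OF this]
  show ?thesis
    unfolding quadratic_ideal_def operad_evaluation_ideal_def operad_evaluation_ideal_axioms_def
    using operad_evaluation_axioms *(1) *(2) by blast
qed


section \<open>The algebras\<close>

text \<open>Coordinates 0 and 1 of \<open>comb_mult c\<close> act on the chain of coordinates 2, 3, 4 by raising
  operators.  For \<open>c = 1\<close> this is a left Leibniz algebra, with coordinate 5 the commutator of the
  two operators; for \<open>c = 0\<close> it satisfies \<open>(x y) z = 0\<close>.\<close>

definition comb_mult :: "'k \<Rightarrow> (nat \<Rightarrow> 'k) \<Rightarrow> (nat \<Rightarrow> 'k) \<Rightarrow> nat \<Rightarrow> 'k::field" where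
  "comb_mult c f g =
     (\<lambda>i. if i = 3 then f 0 * g 2 else if i = 4 then f 1 * g 3 + f 5 * g 2
          else if i = 5 then c * (f 1 * g 0 - f 0 * g 1) else 0)"

text \<open>Strictly upper triangular 4 by 4 matrices: coordinates 0, 1, 2 are the superdiagonal,
  3, 4 the second diagonal, and 5 the corner entry.\<close>

definition triangular_mult :: "(nat \<Rightarrow> 'k) \<Rightarrow> (nat \<Rightarrow> 'k) \<Rightarrow> nat \<Rightarrow> 'k::field" where
  "triangular_mult f g =
     (\<lambda>i. if i = 3 then f 0 * g 1 else if i = 4 then f 1 * g 2
          else if i = 5 then f 0 * g 4 + f 3 * g 2 else 0)"

text \<open>Reading \<open>Succ\<close> as the opposite product serves twice: it is the second
  tensor factor of the generators of the white product, and it makes g1 = h2 and g2 = h1 hold in the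
  algebra.\<close>

definition diop_mult :: "('x \<Rightarrow> 'x \<Rightarrow> 'x) \<Rightarrow> diop \<Rightarrow> 'x \<Rightarrow> 'x \<Rightarrow> 'x" where
  "diop_mult m g x y = (case g of Prec \<Rightarrow> m x y | Succ \<Rightarrow> m y x)"

lemma bilinear_comb_mult: "bilinear_ops (\<lambda>_. comb_mult c)"
  unfolding bilinear_ops_def comb_mult_def by (auto simp: fun_eq_iff algebra_simps)

lemma bilinear_triangular_mult: "bilinear_ops (\<lambda>_. triangular_mult)"
  unfolding bilinear_ops_def triangular_mult_def by (auto simp: fun_eq_iff algebra_simps)

lemma bilinear_diop_mult: "bilinear_ops (\<lambda>_::binop. m) \<Longrightarrow> bilinear_ops (diop_mult m)"
  unfolding bilinear_ops_def diop_mult_def by (auto split: diop.split)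

definition unit_vec :: "nat \<Rightarrow> nat \<Rightarrow> 'k::field" where
  "unit_vec i = (\<lambda>j. if j = i then 1 else 0)"

lemma free_Ops_add: "\<lbrakk>p \<in> Ops free_operad n; q \<in> Ops free_operad n\<rbrakk> \<Longrightarrow> p + q \<in> Ops free_operad n"
  using linear_operad.add_closed[OF linear_operad_free] by simp

lemma free_Ops_diff: "\<lbrakk>p \<in> Ops free_operad n; q \<in> Ops free_operad n\<rbrakk> \<Longrightarrow> p - q \<in> Ops free_operad n"
  by (auto simp: in_keys_iff lookup_minus)

lemma mon_mem_free_Ops: "multilinear n t \<Longrightarrow> mon t \<in> Ops free_operad n"
  by simp

lemma As_relations_Ops: "As_relations \<subseteq> Ops free_operad 3"
  unfolding As_relations_def circ_def
  by (intro insert_subsetI empty_subsetI free_Ops_diff mon_mem_free_Ops)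
    (auto simp: multilinear_def)

lemma Leib_relations_Ops: "Leib_relations \<subseteq> Ops free_operad 3"
  unfolding Leib_relations_def circ_def
  by (intro insert_subsetI empty_subsetI free_Ops_diff free_Ops_add mon_mem_free_Ops)
    (auto simp: multilinear_def)

lemma As_evaluation:
  "operad_evaluation_ideal free_operad (free_eval (\<lambda>_. triangular_mult))
     (quadratic_ideal As_relations)"
  by (rule operad_evaluation_quadratic[OF bilinear_triangular_mult As_relations_Ops])
    (auto simp: free_eval_def As_relations_def circ_def triangular_mult_def)

text \<open>The Leibniz identity says that left multiplication by x y is the commutator of the left
  multiplications by x and by y. Triple products live in coordinate 4 only, and there coordinate 5
  of x y supplies the commutator.\<close>

lemma Leib_evaluation:
  "operad_evaluation_ideal free_operad (free_eval (\<lambda>_. comb_mult 1))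
     (quadratic_ideal Leib_relations)"
  by (rule operad_evaluation_quadratic[OF bilinear_comb_mult Leib_relations_Ops])
    (clarsimp simp: free_eval_def Leib_relations_def circ_def comb_mult_def,
      simp add: algebra_simps)


section \<open>Relations of the white product\<close>

lemma lin_ext_white_map:
  "lin_ext \<phi> (white_map R p) =
     lin_ext (\<lambda>t. \<phi> (op_eval As As_factor 3 t, op_eval (quadratic_operad R) (P_factor R) 3 t)) p"
  by (simp add: white_map_def) (simp add: lin_ext_def)

text \<open>A product of two linear functionals is bilinear and hence kills every relator. Such
  products give necessary conditions for a formal sum of pairs to vanish in the tensor
  product.\<close>

lemma zero_in_tensor_lin_ext:
  assumes "zero_in_tensor P Q n w" "linear_operad P" "linear_operad Q"
    and f: "\<And>f f'. \<lbrakk>f \<in> Ops P n; f' \<in> Ops P n\<rbrakk> \<Longrightarrow> \<phi> (add_op P n f f') = \<phi> f + \<phi> f'"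
      "\<And>c f. f \<in> Ops P n \<Longrightarrow> \<phi> (smult_op P n c f) = c * \<phi> f"
    and g: "\<And>g g'. \<lbrakk>g \<in> Ops Q n; g' \<in> Ops Q n\<rbrakk> \<Longrightarrow> \<psi> (add_op Q n g g') = \<psi> g + \<psi> g'"
      "\<And>c g. g \<in> Ops Q n \<Longrightarrow> \<psi> (smult_op Q n c g) = c * \<psi> g"
  shows "lin_ext (\<lambda>(f, g). \<phi> f * \<psi> g) w = 0"
proof (rule lin_ext_span_eq_0)
  show "w \<in> pm.span (bilinear_relators P Q n)" using assms(1) by (simp add: zero_in_tensor_def)
  show "lin_ext (\<lambda>(f, g). \<phi> f * \<psi> g) b = 0" if "b \<in> bilinear_relators P Q n" for b
    using that unfolding bilinear_relators_def
    by (elim UnE; clarsimp simp: f g; simp add: algebra_simps)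
qed

text \<open>White relations hold for pure tensors in the tensor product of an associative algebra and
  an algebra satisfying \<open>R\<close>.\<close>

lemma white_relations_lin_ext:
  assumes p: "p \<in> white_relations R"
    and m: "operad_evaluation_ideal free_operad (free_eval (\<lambda>_. m)) (quadratic_ideal R)"
  shows "lin_ext (\<lambda>t. tree_eval (\<lambda>_. triangular_mult) u t a * tree_eval (diop_mult m) v t b) p = 0"
proof -
  interpret a: operad_evaluation_ideal free_operad "free_eval (\<lambda>_. triangular_mult)"
    "quadratic_ideal As_relations" by (rule As_evaluation)
  interpret r: operad_evaluation_ideal free_operad "free_eval (\<lambda>_. m)" "quadratic_ideal R"
    by (rule m)
  let ?EA = "quotient_eval (free_eval (\<lambda>_. triangular_mult))" and ?ER = "quotient_eval (free_eval (\<lambda>_. m))"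
  interpret A: operad_evaluation As ?EA
    unfolding As_def quadratic_operad_def by (rule a.operad_evaluation_quotient)
  interpret R: operad_evaluation "quadratic_operad R" ?ER
    unfolding quadratic_operad_def by (rule r.operad_evaluation_quotient)
  have As_gen: "As_factor g \<in> Ops As 2"
    "?EA 2 (As_factor g) w = triangular_mult (w 1) (w 2)" for g w
  proof -
    have x: "mon (Var 1 \<odot> Var 2) \<in> Ops free_operad 2" by (auto simp: circ_def multilinear_def)
    show "As_factor g \<in> Ops As 2"
      unfolding As_factor_def quadratic_class_def As_def quadratic_operad_def a.quotient_Ops
      using x by (rule imageI)
    show "?EA 2 (As_factor g) w = triangular_mult (w 1) (w 2)"
      unfolding As_factor_def quadratic_class_def a.quotient_eval_coset[OF x]
      by (simp add: free_eval_def circ_def)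
  qed
  have P_gen: "P_factor R g \<in> Ops (quadratic_operad R) 2"
    "?ER 2 (P_factor R g) w = diop_mult m g (w 1) (w 2)" for g w
  proof -
    let ?x = "case g of Prec \<Rightarrow> mon (Var 1 \<odot> Var 2) | Succ \<Rightarrow> mon (Var 2 \<odot> Var 1)"
    have x: "?x \<in> Ops free_operad 2"
      by (auto simp: circ_def multilinear_def split: diop.split if_splits)
    show "P_factor R g \<in> Ops (quadratic_operad R) 2"
      unfolding P_factor_def quadratic_class_def quadratic_operad_def r.quotient_Ops
      using x by (rule imageI)
    show "?ER 2 (P_factor R g) w = diop_mult m g (w 1) (w 2)"
      unfolding P_factor_def quadratic_class_def r.quotient_eval_coset[OF x]
      by (simp add: free_eval_def circ_def diop_mult_def split: diop.split)
  qed
  have zero: "zero_in_tensor As (quadratic_operad R) 3 (white_map R p)"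
    and Ops: "\<And>t. t \<in> Poly_Mapping.keys p \<Longrightarrow> multilinear 3 t"
    using p by (auto simp: white_relations_def)
  have "lin_ext (\<lambda>(f, g). ?EA 3 f u a * ?ER 3 g v b) (white_map R p) = 0"
    by (rule zero_in_tensor_lin_ext[OF zero A.linear_operad_axioms R.linear_operad_axioms])
      (simp_all add: A.eval_add A.eval_smult R.eval_add R.eval_smult)
  moreover have "lin_ext (\<lambda>(f, g). ?EA 3 f u a * ?ER 3 g v b) (white_map R p) =
      lin_ext (\<lambda>t. tree_eval (\<lambda>_. triangular_mult) u t a * tree_eval (diop_mult m) v t b) p"
    unfolding lin_ext_white_map
    by (rule lin_ext_cong)
      (simp add: Ops A.eval_op_eval[where \<mu> = "\<lambda>_. triangular_mult", OF As_gen]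
        R.eval_op_eval[where \<mu> = "diop_mult m", OF P_gen])
  ultimately show ?thesis by simp
qed

section \<open>Monomials of arity two and three, and the white relations of Leib\<close>

lemma length_vars_eq_1: "length (vars t) = 1 \<Longrightarrow> \<exists>a. t = Var a"
proof (cases t)
  case (Op g r s)
  assume "length (vars t) = 1"
  then show ?thesis using Op length_vars_pos[of r] length_vars_pos[of s] by simp
qed auto

lemma length_vars_eq_2: "length (vars t) = 2 \<Longrightarrow> \<exists>g a b. t = Op g (Var a) (Var b)"
proof (cases t)
  case (Op g r s)
  assume "length (vars t) = 2"
  then have "length (vars r) = 1" "length (vars s) = 1"
    using length_vars_pos[of r] length_vars_pos[of s]
    unfolding Op vars.simps length_append by linarith+
  then show ?thesis using Op length_vars_eq_1 by blast
qed auto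

lemma multilinear_2_cases:
  assumes "multilinear 2 t"
  obtains g where "t = Op g (Var 1) (Var 2)" | g where "t = Op g (Var 2) (Var 1)"
proof -
  obtain g a b where t: "t = Op g (Var a) (Var b)"
    using length_vars_eq_2 multilinear_length[OF assms] by blast
  have "{a, b} = {1, 2}" "a \<noteq> b"
    using assms by (auto simp: t multilinear_def numeral_2_eq_2 atLeastAtMostSuc_conv)
  then show ?thesis using that t by (auto simp: doubleton_eq_iff)
qed

lemma multilinear_3_cases:
  assumes "multilinear 3 t"
  obtains a b c g h where "distinct [a, b, c]" "vars t = [a, b, c]"
    "t = Op g (Op h (Var a) (Var b)) (Var c) \<or> t = Op g (Var a) (Op h (Var b) (Var c))"
proof -
  have len: "length (vars t) = 3" and dist: "distinct (vars t)"
    using assms multilinear_length[of 3 t] by (auto simp: multilinear_def)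
  then obtain g r s where t: "t = Op g r s" by (cases t) auto
  have "length (vars r) = 2 \<and> length (vars s) = 1 \<or> length (vars r) = 1 \<and> length (vars s) = 2"
    using len length_vars_pos[of r] length_vars_pos[of s]
    unfolding t vars.simps length_append by linarith
  then show ?thesis
  proof
    assume *: "length (vars r) = 2 \<and> length (vars s) = 1"
    obtain h a b c where "r = Op h (Var a) (Var b)" "s = Var c"
      using * length_vars_eq_1 length_vars_eq_2 by blast
    then show ?thesis using that[of a b c g h] t dist by simp
  next
    assume *: "length (vars r) = 1 \<and> length (vars s) = 2"
    obtain h a b c where "r = Var a" "s = Op h (Var b) (Var c)"
      using * length_vars_eq_1 length_vars_eq_2 by blast
    then show ?thesis using that[of a b c g h] t dist by simp
  qed
qed

text \<open>The surviving trees are those which become left combs \<open>(x y) z\<close> when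
  \<open>x \<succ> y\<close> is read as \<open>y x\<close>.\<close>

lemma Leib_white_relations_lookup:
  fixes p :: "diop monomial \<Rightarrow>\<^sub>0 'k::field"
  assumes p: "p \<in> white_relations Leib_relations" and abc: "distinct [a, b, c]"
  shows "Poly_Mapping.lookup p (Op Succ (Op h (Var a) (Var b)) (Var c)) = 0"
    and "Poly_Mapping.lookup p (Op Prec (Var a) (Op h (Var b) (Var c))) = 0"
proof -
  \<comment> \<open>The matrix units E12, E23, E34 are assigned to a, b, c. The corner entry
    (coordinate 5) of a triple product is then 1 if the leaves read a, b, c from left to right and 0
    otherwise, which isolates the eight trees in \<open>T\<close>.\<close>
  define u :: "nat \<Rightarrow> nat \<Rightarrow> 'k" where
    "u = (\<lambda>_ _. 0)(a := unit_vec 0, b := unit_vec 1, c := unit_vec 2)"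
  define T where "T =
    {Op Prec (Op Prec (Var a) (Var b)) (Var c), Op Prec (Op Succ (Var a) (Var b)) (Var c),
     Op Succ (Op Prec (Var a) (Var b)) (Var c), Op Succ (Op Succ (Var a) (Var b)) (Var c),
     Op Prec (Var a) (Op Prec (Var b) (Var c)), Op Prec (Var a) (Op Succ (Var b) (Var c)),
     Op Succ (Var a) (Op Prec (Var b) (Var c)), Op Succ (Var a) (Op Succ (Var b) (Var c))}"
  have diop: "g = Prec \<or> g = Succ" for g by (cases g) auto
  have T: "tree_eval (\<lambda>_. triangular_mult) u t 5 = 0"
    if t: "t \<in> Poly_Mapping.keys p" "t \<notin> T" for t
  proof -
    have "multilinear 3 t" using p t by (auto simp: white_relations_def)
    then obtain a' b' c' g h where t': "distinct [a', b', c']"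
      "t = Op g (Op h (Var a') (Var b')) (Var c') \<or> t = Op g (Var a') (Op h (Var b') (Var c'))"
      by (rule multilinear_3_cases)
    have "(a', b', c') \<noteq> (a, b, c)"
      using t(2) t'(2) diop[of g] diop[of h] unfolding T_def by auto
    moreover have "tree_eval (\<lambda>_. triangular_mult) u t 5 = u a' 0 * u b' 1 * u c' 2"
      using t'(2) by (auto simp: triangular_mult_def)
    ultimately show ?thesis using abc by (auto simp: u_def unit_vec_def)
  qed
  have sum: "(\<Sum>t\<in>T. Poly_Mapping.lookup p t *
      (tree_eval (\<lambda>_. triangular_mult) u t 5 * tree_eval (diop_mult (comb_mult 1)) v t 4)) = 0" for v
    using white_relations_lin_ext[OF p Leib_evaluation, of u 5 v 4]
    by (subst (asm) lin_ext_eq_sum[of T]) (auto simp: T T_def)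
  note simps = T_def u_def diop_mult_def comb_mult_def triangular_mult_def unit_vec_def
  \<comment> \<open>Write e_i for \<open>unit_vec i\<close>. The tree reads c (a b) and takes the
    value e_1 (e_0 e_2) = e_4; the other seven trees have coordinate 4 equal to 0.\<close>
  have "Poly_Mapping.lookup p (Op Succ (Op Prec (Var a) (Var b)) (Var c)) = 0"
    using sum[of "(\<lambda>_ _. 0)(a := unit_vec 0, b := unit_vec 2, c := unit_vec 1)"] abc by (simp add: simps)
  \<comment> \<open>The tree reads c (b a), with a = e_2 and b = c = e_0 + e_1. Equal vectors at b
    and c have zero commutator, which kills (b c) a and (c b) a and leaves this tree alone.\<close>
  moreover have "Poly_Mapping.lookup p (Op Succ (Op Succ (Var a) (Var b)) (Var c)) = 0"
    using sum[of "\<lambda>j i. if j = a then unit_vec 2 i else unit_vec 0 i + unit_vec 1 i"] abc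
    by (simp add: simps)
  ultimately show "Poly_Mapping.lookup p (Op Succ (Op h (Var a) (Var b)) (Var c)) = 0"
    using diop[of h] by auto
  \<comment> \<open>The same two choices with the roles of a and c exchanged isolate a (b c) and,
    below, a (c b).\<close>
  have "Poly_Mapping.lookup p (Op Prec (Var a) (Op Prec (Var b) (Var c))) = 0"
    using sum[of "\<lambda>j i. if j = c then unit_vec 2 i else unit_vec 0 i + unit_vec 1 i"] abc
    by (simp add: simps)
  moreover have "Poly_Mapping.lookup p (Op Prec (Var a) (Op Succ (Var b) (Var c))) = 0"
    using sum[of "(\<lambda>_ _. 0)(a := unit_vec 1, b := unit_vec 2, c := unit_vec 0)"] abc by (simp add: simps)
  ultimately show "Poly_Mapping.lookup p (Op Prec (Var a) (Op h (Var b) (Var c))) = 0"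
    using diop[of h] by auto
qed

text \<open>Every tree occurring in a white relation becomes a left comb (x y) z. For c = 0 a
  product has zero coordinates 0, 1 and 5, the only ones read from a left factor, so each tree
  vanishes separately.\<close>

lemma Leib_white_product_evaluation:
  "operad_evaluation_ideal free_operad (free_eval (diop_mult (comb_mult 0)))
     (quadratic_ideal (white_relations Leib_relations))"
proof (rule operad_evaluation_quadratic[OF bilinear_diop_mult[OF bilinear_comb_mult]])
  show "white_relations Leib_relations \<subseteq> Ops free_operad 3"
    by (auto simp: white_relations_def)
  fix p :: "diop monomial \<Rightarrow>\<^sub>0 'a" and v :: "nat \<Rightarrow> nat \<Rightarrow> 'a" and x
  assume p: "p \<in> white_relations Leib_relations"
  have "tree_eval (diop_mult (comb_mult 0)) v t x = 0" if t: "t \<in> Poly_Mapping.keys p" for t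
  proof -
    have "multilinear 3 t" using p t by (auto simp: white_relations_def)
    then obtain a b c g h where abc: "distinct [a, b, c]"
      "t = Op g (Op h (Var a) (Var b)) (Var c) \<or> t = Op g (Var a) (Op h (Var b) (Var c))"
      by (rule multilinear_3_cases)
    have "Poly_Mapping.lookup p t \<noteq> 0" using t by (simp add: in_keys_iff)
    then have "t = Op Prec (Op h (Var a) (Var b)) (Var c) \<or> t = Op Succ (Var a) (Op h (Var b) (Var c))"
      using Leib_white_relations_lookup[OF p abc(1), of h] abc(2) by (cases g) auto
    then show ?thesis
      by (cases h) (auto simp: diop_mult_def comb_mult_def)
  qed
  then show "free_eval (diop_mult (comb_mult 0)) 3 p v x = 0"
    by (simp add: free_eval_def lin_ext_def)
qed


section \<open>The Leibniz operad\<close>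

lemma pcomp_single:
  "pcomp free_operad m n i (mon s) (mon t) = mon (graft n i s t)"
  by (simp add: free_operad_def)

lemma act_single:
  "act free_operad n \<sigma> (mon t) = mon (rename \<sigma> t)"
  by (simp add: free_operad_def)

lemma permutes_transpose_12: "2 \<le> n \<Longrightarrow> transpose 1 2 permutes {1..n::nat}"
  by (rule permutes_swap_id) auto

text \<open>Since \<open>Succ\<close> is the opposite of \<open>Prec\<close>, the four basis
  monomials take only two values. The coefficients depend on p alone, not on the product m.\<close>

lemma free_Ops_2_diop:
  fixes p :: "diop monomial \<Rightarrow>\<^sub>0 'k::field"
  assumes "p \<in> Ops free_operad 2"
  obtains \<alpha> \<beta> where "\<And>m v x. free_eval (diop_mult m) 2 p v x =
    \<alpha> * m (v 1) (v 2) x + \<beta> * m (v 2) (v 1) x"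
proof -
  let ?T = "{Op Prec (Var 1) (Var 2), Op Succ (Var 1) (Var 2), Op Prec (Var 2) (Var 1),
    Op Succ (Var 2) (Var 1)}"
  let ?c = "Poly_Mapping.lookup p"
  have T: "t \<in> ?T" if "t \<in> Poly_Mapping.keys p" for t
  proof -
    have "multilinear 2 t" using that assms by simp
    then show ?thesis
    proof (cases rule: multilinear_2_cases)
      case (1 g) then show ?thesis by (cases g) auto
    next
      case (2 g) then show ?thesis by (cases g) auto
    qed
  qed
  have "free_eval (diop_mult m) 2 p v x =
      (?c (Op Prec (Var 1) (Var 2)) + ?c (Op Succ (Var 2) (Var 1))) * m (v 1) (v 2) x +
      (?c (Op Succ (Var 1) (Var 2)) + ?c (Op Prec (Var 2) (Var 1))) * m (v 2) (v 1) x" for m v x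
    unfolding free_eval_def
    by (subst lin_ext_eq_sum[of ?T]) (use T in \<open>auto simp: diop_mult_def algebra_simps\<close>)
  then show ?thesis by (rule that)
qed

lemma free_Ops_2_binop:
  fixes p :: "binop monomial \<Rightarrow>\<^sub>0 'k::field"
  assumes "p \<in> Ops free_operad 2"
  obtains \<alpha> \<beta> where "p = pm_scale \<alpha> (mon (Var 1 \<odot> Var 2)) + pm_scale \<beta> (mon (Var 2 \<odot> Var 1))"
proof -
  have T: "t = Var 1 \<odot> Var 2 \<or> t = Var 2 \<odot> Var 1" if "t \<in> Poly_Mapping.keys p" for t
  proof -
    have "multilinear 2 t" using that assms by simp
    then show ?thesis
    proof (cases rule: multilinear_2_cases)
      case (1 g) then show ?thesis by (cases g) (simp add: circ_def)
    next
      case (2 g) then show ?thesis by (cases g) (simp add: circ_def)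
    qed
  qed
  have "p = pm_scale (Poly_Mapping.lookup p (Var 1 \<odot> Var 2)) (mon (Var 1 \<odot> Var 2)) +
      pm_scale (Poly_Mapping.lookup p (Var 2 \<odot> Var 1)) (mon (Var 2 \<odot> Var 1))"
  proof (rule poly_mapping_eqI)
    fix t
    have "Poly_Mapping.lookup p t = 0" if "t \<noteq> Var 1 \<odot> Var 2" "t \<noteq> Var 2 \<odot> Var 1"
      using T[of t] that by (auto simp: in_keys_iff)
    moreover have "Var 1 \<odot> Var 2 \<noteq> Var 2 \<odot> Var 1" by (simp add: circ_def)
    ultimately show "Poly_Mapping.lookup p t = Poly_Mapping.lookup
        (pm_scale (Poly_Mapping.lookup p (Var 1 \<odot> Var 2)) (mon (Var 1 \<odot> Var 2)) +
         pm_scale (Poly_Mapping.lookup p (Var 2 \<odot> Var 1)) (mon (Var 2 \<odot> Var 1))) t"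
      by (auto simp: lookup_add lookup_single when_def)
  qed
  then show ?thesis by (rule that)
qed

theorem lemma2p12:
  shows "\<not> admits_nonsymmetric_version (Leib_relations :: (binop monomial \<Rightarrow>\<^sub>0 'k::field) set)"
proof
  assume "admits_nonsymmetric_version (Leib_relations :: (binop monomial \<Rightarrow>\<^sub>0 'k) set)"
  define R where "R = (Leib_relations :: (binop monomial \<Rightarrow>\<^sub>0 'k) set)"
  define L where "L = quadratic_operad R"
  define W where "W = As_white_product R"
  define G where "G = generated_ideal W (identification_relations R)"
  define Q where "Q = quotient_operad W G"
  let ?\<mu> = "diop_mult (comb_mult 0) :: diop \<Rightarrow> (nat \<Rightarrow> 'k) \<Rightarrow> (nat \<Rightarrow> 'k) \<Rightarrow> nat \<Rightarrow> 'k"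
  let ?\<tau> = "transpose 1 2 :: nat \<Rightarrow> nat"
  obtain \<phi> where iso: "operad_iso Q L \<phi>"
    using \<open>admits_nonsymmetric_version _\<close>
    unfolding admits_nonsymmetric_version_def operad_isomorphic_def Q_def L_def W_def G_def R_def
    by blast

  \<comment> \<open>Evaluating the white product and its quotient in the algebra with (x y) z =
    0\<close>
  interpret l: operad_evaluation_ideal free_operad "free_eval (\<lambda>_. comb_mult (1 :: 'k))"
    "quadratic_ideal R" unfolding R_def by (rule Leib_evaluation)
  have L: "L = quotient_operad free_operad (quadratic_ideal R)"
    by (simp add: L_def quadratic_operad_def)
  interpret w: operad_evaluation_ideal free_operad "free_eval ?\<mu>"
    "quadratic_ideal (white_relations R)" unfolding R_def by (rule Leib_white_product_evaluation)
  have W: "W = quotient_operad free_operad (quadratic_ideal (white_relations R))"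
    by (simp add: W_def As_white_product_def quadratic_operad_def)
  define EW where "EW = quotient_eval (free_eval ?\<mu>)"
  interpret W: operad_evaluation W EW
    unfolding W EW_def by (rule w.operad_evaluation_quotient)
  have gen2: "h1 \<in> Ops free_operad 2" "h2 \<in> Ops free_operad 2"
    "g1 \<in> Ops free_operad 2" "g2 \<in> Ops free_operad 2"
    by (auto simp: h1_def h2_def g1_def g2_def multilinear_def)
  have ident: "identification_relations R n \<subseteq> W.identities n" for n
  proof -
    have "sub_op W 2 (w.cl 2 f) (w.cl 2 g) \<in> W.identities 2"
      if f: "f \<in> Ops free_operad 2" and g: "g \<in> Ops free_operad 2"
        and eq: "\<And>v x. free_eval ?\<mu> 2 f v x = free_eval ?\<mu> 2 g v x" for f g
    proof -
      have cl: "w.cl 2 f \<in> Ops W 2" "w.cl 2 g \<in> Ops W 2"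
        using f g unfolding W w.quotient_Ops by blast+
      moreover have "EW 2 (w.cl 2 f) v x = EW 2 (w.cl 2 g) v x" for v x
        unfolding EW_def using f g eq by (simp only: w.quotient_eval_coset)
      ultimately show ?thesis
        unfolding W.identities_def sub_op_def
        by (simp add: W.add_closed W.smult_closed W.eval_add W.eval_smult)
    qed
    from this[OF gen2(3,2)] this[OF gen2(4,1)] show ?thesis
      unfolding identification_relations_def quadratic_class_def W_def[symmetric]
      by (auto simp: Let_def free_eval_def g1_def g2_def h1_def h2_def diop_mult_def)
  qed
  have "operad_evaluation_ideal W EW G"
    unfolding G_def operad_evaluation_ideal_def operad_evaluation_ideal_axioms_def
    using W.operad_evaluation_axioms W.generated_ideal_identities[OF ident] by blast
  then interpret q: operad_evaluation_ideal W EW G .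
  define E where "E = quotient_eval EW"
  interpret Q: operad_evaluation Q E
    unfolding Q_def E_def by (rule q.operad_evaluation_quotient)
  interpret L: linear_operad L unfolding L by (rule l.linear_operad_quotient)

  have \<phi>_bij: "bij_betw (\<phi> n) (Ops Q n) (Ops L n)"
    and \<phi>_add: "\<lbrakk>f \<in> Ops Q n; g \<in> Ops Q n\<rbrakk> \<Longrightarrow>
      \<phi> n (add_op Q n f g) = add_op L n (\<phi> n f) (\<phi> n g)"
    and \<phi>_smult: "f \<in> Ops Q n \<Longrightarrow> \<phi> n (smult_op Q n c f) = smult_op L n c (\<phi> n f)"
    and \<phi>_act: "\<lbrakk>f \<in> Ops Q n; \<sigma> permutes {1..n}\<rbrakk> \<Longrightarrow>
      \<phi> n (act Q n \<sigma> f) = act L n \<sigma> (\<phi> n f)"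
    and \<phi>_pcomp: "\<lbrakk>i \<in> {1..m}; f \<in> Ops Q m; g \<in> Ops Q n\<rbrakk> \<Longrightarrow>
      \<phi> (m + n - 1) (pcomp Q m n i f g) = pcomp L m n i (\<phi> m f) (\<phi> n g)"
    for m n i c \<sigma> f g
    using iso unfolding operad_iso_def by blast+
  have \<phi>_inj: "f = g" if "f \<in> Ops Q n" "g \<in> Ops Q n" "\<phi> n f = \<phi> n g" for f g n
    using \<phi>_bij[of n] that by (auto simp: bij_betw_def inj_on_def)

  \<comment> \<open>The Leibniz identity for the operation corresponding to the generator of
    Leib\<close>
  define m :: "binop monomial \<Rightarrow>\<^sub>0 'k" where "m = mon (Var 1 \<odot> Var 2)"
  have m: "m \<in> Ops free_operad 2" by (auto simp: m_def circ_def multilinear_def)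
  then have "l.cl 2 m \<in> Ops L 2" unfolding L l.quotient_Ops by blast
  then obtain \<nu> where \<nu>: "\<nu> \<in> Ops Q 2" "\<phi> 2 \<nu> = l.cl 2 m"
    using \<phi>_bij[of 2] by (metis bij_betw_def imageE)

  have \<nu>_pcomp: "pcomp Q 2 2 i \<nu> \<nu> \<in> Ops Q 3"
    "\<phi> 3 (pcomp Q 2 2 i \<nu> \<nu>) = l.cl 3 (pcomp free_operad 2 2 i m m)"
    "pcomp free_operad 2 2 i m m \<in> Ops free_operad 3"
    "E 3 (pcomp Q 2 2 i \<nu> \<nu>) v = E 2 \<nu> (subst_arg 2 i (E 2 \<nu>) v)"
    if "i \<in> {1..2}" for i v
    using that Q.pcomp_closed[of i 2 \<nu> \<nu> 2] \<phi>_pcomp[of i 2 \<nu> \<nu> 2]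
      l.quotient_pcomp[of i 2 m m 2] l.pcomp_closed[of i 2 m m 2] Q.eval_pcomp[of i 2 \<nu> \<nu> 2 v]
      \<nu> m by (simp_all add: L)
  have p12: "1 \<in> {1..2::nat}" "2 \<in> {1..2::nat}" by auto
  have \<tau>: "?\<tau> permutes {1..2}" "?\<tau> permutes {1..3}"
    by (intro permutes_transpose_12; simp)+
  \<comment> \<open>\<open>\<rho>\<close> is the left side of the Leibniz identity for
    \<open>\<nu>\<close> in the quotient, and \<open>r\<close> the same expression for
    \<open>m\<close> in the free operad. The transposition turns x1 (x2 x3) into x2 (x1 x3).\<close>
  define \<rho> where "\<rho> = add_op Q 3
    (add_op Q 3 (pcomp Q 2 2 1 \<nu> \<nu>) (smult_op Q 3 (- 1) (pcomp Q 2 2 2 \<nu> \<nu>)))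
    (act Q 3 ?\<tau> (pcomp Q 2 2 2 \<nu> \<nu>))"
  define r where "r = pcomp free_operad 2 2 1 m m + pm_scale (- 1) (pcomp free_operad 2 2 2 m m) +
    act free_operad 3 ?\<tau> (pcomp free_operad 2 2 2 m m)"
  note Q_closed = Q.add_closed Q.smult_closed Q.act_closed[OF _ \<tau>(2)] \<nu>_pcomp(1)[OF p12(1)]
    \<nu>_pcomp(1)[OF p12(2)]
  have \<rho>: "\<rho> \<in> Ops Q 3" unfolding \<rho>_def by (intro Q_closed)
  note F_closed = l.add_closed l.smult_closed l.act_closed[OF _ \<tau>(2)]
    \<nu>_pcomp(3)[OF p12(1)] \<nu>_pcomp(3)[OF p12(2)]
  have "\<phi> 3 \<rho> = l.cl 3 (add_op free_operad 3 (add_op free_operad 3 (pcomp free_operad 2 2 1 m m)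
      (smult_op free_operad 3 (- 1) (pcomp free_operad 2 2 2 m m)))
    (act free_operad 3 ?\<tau> (pcomp free_operad 2 2 2 m m)))"
    unfolding \<rho>_def
    by (simp only: \<phi>_add \<phi>_smult \<phi>_act \<tau> Q_closed \<nu>_pcomp(2)[OF p12(1)] \<nu>_pcomp(2)[OF p12(2)]
        L l.quotient_add l.quotient_smult l.quotient_act F_closed)
  then have "\<phi> 3 \<rho> = l.cl 3 r" by (simp add: r_def)
  moreover have "r \<in> quadratic_ideal R 3"
  proof -
    have "r = mon ((Var 1 \<odot> Var 2) \<odot> Var 3) - mon (Var 1 \<odot> (Var 2 \<odot> Var 3))
      + mon (Var 2 \<odot> (Var 1 \<odot> Var 3))"
      unfolding r_def m_def pcomp_single act_single circ_def
      by (simp add: act_single eval_nat_numeral pm.scale_minus_left)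
    then have "r \<in> R" by (simp add: R_def Leib_relations_def)
    then show ?thesis
      unfolding quadratic_ideal_def
      using l.generated_ideal_incl[of "\<lambda>n. if n = 3 then R else {}" 3] by auto
  qed
  ultimately have \<phi>\<rho>: "\<phi> 3 \<rho> = l.cl 3 0" using l.coset_ideal[of r 3] by simp
  \<comment> \<open>\<open>operad_iso\<close> does not mention zero elements, so vanishing is
    transported through scaling by 0: injectivity gives \<open>\<rho>\<close> = 0
    \<open>\<rho>\<close>, whose value is 0.\<close>
  have "\<phi> 3 (smult_op Q 3 0 \<rho>) = \<phi> 3 \<rho>"
    using \<rho> l.quotient_smult[of 0 3 0] by (simp add: \<phi>_smult \<phi>\<rho> L)
  then have "smult_op Q 3 0 \<rho> = \<rho>" using \<phi>_inj \<rho> Q.smult_closed by blast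
  then have E\<rho>: "E 3 \<rho> v x = 0" for v x using Q.eval_smult[OF \<rho>, of 0 v x] by simp

  obtain p where p: "p \<in> Ops free_operad 2" "\<nu> = q.cl 2 (w.cl 2 p)"
    using \<nu>(1) unfolding Q_def q.quotient_Ops unfolding W w.quotient_Ops by blast
  have E_cl: "E 2 (q.cl 2 (w.cl 2 f)) = free_eval ?\<mu> 2 f" "q.cl 2 (w.cl 2 f) \<in> Ops Q 2"
    if f: "f \<in> Ops free_operad 2" for f
  proof -
    have cl: "w.cl 2 f \<in> Ops W 2" using f unfolding W w.quotient_Ops by blast
    then show "q.cl 2 (w.cl 2 f) \<in> Ops Q 2" unfolding Q_def q.quotient_Ops by blast
    show "E 2 (q.cl 2 (w.cl 2 f)) = free_eval ?\<mu> 2 f"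
      unfolding E_def q.quotient_eval_coset[OF cl] unfolding EW_def w.quotient_eval_coset[OF f] ..
  qed
  obtain \<alpha> \<beta> where E\<nu>: "E 2 \<nu> v =
    (\<lambda>x. \<alpha> * comb_mult 0 (v 1) (v 2) x + \<beta> * comb_mult 0 (v 2) (v 1) x)" for v
    using free_Ops_2_diop[OF p(1)] unfolding p(2) E_cl(1)[OF p(1)] by metis
  have E_leib: "E 2 \<nu> (subst_arg 2 1 (E 2 \<nu>) v) x - E 2 \<nu> (subst_arg 2 2 (E 2 \<nu>) v) x
      + E 2 \<nu> (subst_arg 2 2 (E 2 \<nu>) (v \<circ> ?\<tau>)) x = 0" for v x
  proof -
    have "E 3 \<rho> v x = E 3 (pcomp Q 2 2 1 \<nu> \<nu>) v x + - 1 * E 3 (pcomp Q 2 2 2 \<nu> \<nu>) v x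
        + E 3 (pcomp Q 2 2 2 \<nu> \<nu>) (v \<circ> ?\<tau>) x"
      unfolding \<rho>_def by (simp only: Q.eval_add Q.eval_smult Q.eval_act \<tau> Q_closed)
    then show ?thesis
      using E\<rho>[of v x]
      by (simp add: \<nu>_pcomp(4)[OF p12(1)] \<nu>_pcomp(4)[OF p12(2)] del: One_nat_def)
  qed
  note simps = E\<nu> subst_arg_simps comb_mult_def unit_vec_def
  \<comment> \<open>With x1, x2, x3 = e_1, e_0, e_2 the only surviving product is x1 (x2 x3) = e_4,
    and its coefficient is -\<alpha>^2.\<close>
  have "\<alpha> = 0"
    using E_leib[of "(\<lambda>_ _. 0)(1 := unit_vec 1, 2 := unit_vec 0, 3 := unit_vec 2)" 4]
    by (simp add: simps del: One_nat_def)
  \<comment> \<open>With x1, x2, x3 = e_2, e_0, e_1 the only surviving product is x3 (x2 x1) = e_4,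
    and its coefficient is \<beta>^2.\<close>
  moreover have "\<beta> = 0"
    using E_leib[of "(\<lambda>_ _. 0)(1 := unit_vec 2, 2 := unit_vec 0, 3 := unit_vec 1)" 4]
    by (simp add: simps del: One_nat_def)
  ultimately have E\<nu>0: "E 2 \<nu> v x = 0" for v x by (simp add: E\<nu>)

  \<comment> \<open>Contradiction in arity two\<close>
  define h where "h = q.cl 2 (w.cl 2 h1)"
  have h: "h \<in> Ops Q 2" "E 2 h = free_eval ?\<mu> 2 h1" unfolding h_def using E_cl gen2(1) by blast+
  then have "\<phi> 2 h \<in> Ops L 2" using \<phi>_bij[of 2] by (auto simp: bij_betw_def)
  then obtain f where f: "f \<in> Ops free_operad 2" "\<phi> 2 h = l.cl 2 f"
    unfolding L l.quotient_Ops by blast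
  obtain a b where ab: "f = pm_scale a (mon (Var 1 \<odot> Var 2)) + pm_scale b (mon (Var 2 \<odot> Var 1))"
    using free_Ops_2_binop[OF f(1)] by blast
  \<comment> \<open>Leib(2) is spanned by the generator and its transpose, so h is a combination of
    \<open>\<nu>\<close> and its transpose and vanishes on the algebra.\<close>
  let ?h = "add_op Q 2 (smult_op Q 2 a \<nu>) (smult_op Q 2 b (act Q 2 ?\<tau> \<nu>))"
  note Q2_closed = Q.add_closed Q.smult_closed Q.act_closed[OF _ \<tau>(1)] \<nu>(1)
  note F2_closed = l.add_closed l.smult_closed l.act_closed[OF _ \<tau>(1)] m
  have f': "f = add_op free_operad 2 (smult_op free_operad 2 a m)
      (smult_op free_operad 2 b (act free_operad 2 ?\<tau> m))"
    by (simp add: ab m_def act_single circ_def)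
  have "\<phi> 2 ?h = \<phi> 2 h"
    unfolding f(2) f'
    by (simp only: \<phi>_add \<phi>_smult \<phi>_act \<tau> Q2_closed \<nu>(2)
        L l.quotient_add l.quotient_smult l.quotient_act F2_closed)
  then have "?h = h" by (rule \<phi>_inj[rotated 2]) (intro Q2_closed h)+
  moreover have "E 2 ?h v x = 0" for v x
    by (simp only: Q.eval_add Q.eval_smult Q.eval_act \<tau> Q2_closed E\<nu>0) simp
  ultimately have "free_eval ?\<mu> 2 h1 v x = 0" for v x using h(2) by metis
  \<comment> \<open>The class of \<open>h1\<close> evaluates to e_0 e_2 = e_3, which is not
    zero.\<close>
  from this[of "(\<lambda>_ _. 0)(1 := unit_vec 0, 2 := unit_vec 2)" 3] show False
    by (simp add: free_eval_def h1_def diop_mult_def comb_mult_def unit_vec_def)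
qed

end
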